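(* Let $|q|<1$ and $a,b,c,d,u,v,\alpha,\beta\in\mathbb{C}$, and suppose there are no zero factors in the denominator of the integral below. Then \[ \int_u^v\frac{(qx/u,qx/v,\alpha ax,\beta cx;q)_\infty}{(ax,bx,cx,dx;q)_\infty}\,d_qx =(1-q)v(q,u/v,qv/u;q)_\infty\sum_{m,n=0}^\infty\Phi^{(\alpha)}_m(a,b|q)\Phi^{(\beta)}_n(c,d|q)\frac{h_{m+n}(u,v|q)}{(q;q)_m(q;q)_n}. \]
   Context: $(a;q)_n=\prod_{k=0}^{n-1}(1-aq^k)$, $(a;q)_\infty=\prod_{k\ge0}(1-aq^k)$, $(a_1,\ldots,a_m;q)_n=(a_1;q)_n\cdots(a_m;q)_n$; ${n\brack k}_q=\frac{(q;q)_n}{(q;q)_k(q;q)_{n-k}}$. The Jackson $q$-integral is $\int_a^b f(x)\,d_qx=(1-q)\sum_{n=0}^\infty[bf(bq^n)-af(aq^n)]q^n$. The homogeneous Hahn polynomials are $\Phi^{(\alpha)}_n(x,y|q)=\sum_{k=0}^n{n\brack k}_q(\alpha;q)_kx^ky^{n-k}$ and the homogeneous Rogers–Szegő polynomials are $h_n(x,y|q)=\sum_{k=0}^n{n\brack k}_qx^ky^{n-k}$.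
   Formalization: The double series on the right diverges for some admissible parameters (e.g. q=1/2, u=1, v=-1, a=3, the rest 0), so the identity is stated when it converges absolutely, which is proved if |wu|,|wv|<1 for w=a,b,c,d; u and v are taken nonzero. *)

theory Defs
  imports "HOL-Analysis.Analysis"
begin

definition qpoch :: "complex \<Rightarrow> complex \<Rightarrow> nat \<Rightarrow> complex" where
  "qpoch a q n = (\<Prod>k<n. 1 - a * q ^ k)"

text \<open>For norm q < 1 the product converges; \<^const>\<open>prodinf\<close> is then 0 exactly
  when some factor vanishes.\<close>

definition qpoch_inf :: "complex \<Rightarrow> complex \<Rightarrow> complex" where
  "qpoch_inf a q = (\<Prod>k. 1 - a * q ^ k)"

definition qpochs_inf :: "complex list \<Rightarrow> complex \<Rightarrow> complex" where
  "qpochs_inf as q = (\<Prod>a\<leftarrow>as. qpoch_inf a q)"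

definition qbinom :: "complex \<Rightarrow> nat \<Rightarrow> nat \<Rightarrow> complex" where
  "qbinom q n k = qpoch q q n / (qpoch q q k * qpoch q q (n - k))"

definition jackson_integral :: "complex \<Rightarrow> complex \<Rightarrow> complex \<Rightarrow> (complex \<Rightarrow> complex) \<Rightarrow> complex" where
  "jackson_integral q a b f =
     (1 - q) * (\<Sum>n. (b * f (b * q ^ n) - a * f (a * q ^ n)) * q ^ n)"

definition hom_hahn :: "complex \<Rightarrow> nat \<Rightarrow> complex \<Rightarrow> complex \<Rightarrow> complex \<Rightarrow> complex" where
  "hom_hahn \<alpha> n x y q = (\<Sum>k\<le>n. qbinom q n k * qpoch \<alpha> q k * x ^ k * y ^ (n - k))"

definition hom_rogers_szego :: "nat \<Rightarrow> complex \<Rightarrow> complex \<Rightarrow> complex \<Rightarrow> complex" where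
  "hom_rogers_szego n x y q = (\<Sum>k\<le>n. qbinom q n k * x ^ k * y ^ (n - k))"

end

theory Submission
  imports Defs "HOL-Complex_Analysis.Complex_Analysis"
begin

text \<open>
  Write \<open>W x = (qx/u, qx/v; q)\<^sub>\<infinity>\<close> and let \<open>M\<^sub>N\<close> be the Jackson integral of \<open>W x x\<^sup>N\<close> over \<open>[u, v]\<close>, divided
  by \<open>1 - q\<close>. Telescoping \<open>x\<^sup>N (x/u, x/v; q)\<^sub>\<infinity>\<close> gives \<open>M\<^sub>N\<close> the three-term recurrence of \<open>h\<^sub>N(u, v)\<close>, so
  \<open>M\<^sub>N = M\<^sub>0 h\<^sub>N\<close>. For \<open>|u| < |v|\<close>, letting \<open>N\<close> tend to infinity in \<open>M\<^sub>N / v\<^sup>N\<close> evaluates \<open>M\<^sub>0\<close> as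
  \<open>v (q, u/v, qv/u; q)\<^sub>\<infinity>\<close>, and continuation in \<open>u\<close> removes the restriction.

  If \<open>|wu|, |wv| < 1\<close> for all \<open>w\<close> among \<open>a, b, c, d\<close>, the \<open>q\<close>-binomial theorem expands the remaining factor of the
  integrand into a double power series in \<open>x\<close>, which may be integrated term by term. In general scale
  \<open>a, b, c, d\<close> by \<open>s\<close>: after clearing the denominators \<open>(asx, bsx, csx, dsx; q)\<^sub>\<infinity>\<close> at \<open>x = u, v\<close> both sides are
  holomorphic for \<open>|s| < 1\<close>, hence equal there, and \<open>s\<close> can tend to \<open>1\<close> since the double series at \<open>s = 1\<close>
  converges absolutely.
\<close>

section \<open>General facts on bounds, limits of series and double sums\<close>

lemma one_minus_ne_0: "norm z < 1 \<Longrightarrow> 1 - z \<noteq> (0::complex)"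
  by auto

lemma entire_bounded:
  assumes "f holomorphic_on (UNIV :: complex set)"
  shows "\<exists>K. \<forall>x. norm x \<le> R \<longrightarrow> norm (f x :: complex) \<le> K"
proof -
  have "compact (f ` cball 0 R)"
    using assms by (intro compact_continuous_image) (auto intro: continuous_on_subset holomorphic_on_imp_continuous_on)
  hence "bounded (f ` cball 0 R)" by (rule compact_imp_bounded)
  then obtain K where "\<And>x. x \<in> cball 0 R \<Longrightarrow> norm (f x) \<le> K" unfolding bounded_iff by blast
  thus ?thesis by (intro exI[of _ K]) simp
qed

text \<open>Dominated convergence for series. It serves both for the asymptotics in \<open>N\<close>
  and for letting the scaling parameter tend to 1.\<close>

lemma tannery_sequentially:
  fixes a :: "nat \<Rightarrow> nat \<Rightarrow> complex"
  assumes "\<And>k. (\<lambda>n. a k n) \<longlonglongrightarrow> b k" "\<And>k n. norm (a k n) \<le> M k" "summable M"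
  shows "(\<lambda>n. \<Sum>k. a k n) \<longlonglongrightarrow> suminf b"
  using tannerys_theorem[of a b sequentially M] assms by (simp add: case_prod_unfold)

lemma abs_summable_on_Times:
  fixes f :: "'a \<Rightarrow> complex" and g :: "'b \<Rightarrow> complex"
  assumes f: "(\<lambda>x. norm (f x)) summable_on A" and g: "(\<lambda>y. norm (g y)) summable_on B"
  shows "(\<lambda>p. norm (case p of (x, y) \<Rightarrow> f x * g y)) summable_on A \<times> B"
proof -
  have "(\<lambda>p. norm (f (fst p)) * norm (g (snd p))) summable_on (A \<times> B)"
  proof (rule summable_on_SigmaI)
    show "((\<lambda>y. norm (f (fst (x, y))) * norm (g (snd (x, y)))) has_sum
            norm (f x) * infsum (\<lambda>y. norm (g y)) B) B" for x
      using has_sum_cmult_right[OF has_sum_infsum[OF g]] by simp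
    show "(\<lambda>x. norm (f x) * infsum (\<lambda>y. norm (g y)) B) summable_on A"
      by (intro summable_on_cmult_left f)
  qed simp
  thus ?thesis by (simp add: case_prod_unfold norm_mult)
qed

lemma has_sum_Times:
  fixes f :: "'a \<Rightarrow> complex" and g :: "'b \<Rightarrow> complex"
  assumes f: "(\<lambda>x. norm (f x)) summable_on A" "(f has_sum s) A"
    and g: "(\<lambda>y. norm (g y)) summable_on B" "(g has_sum t) B"
  shows "((\<lambda>(x, y). f x * g y) has_sum s * t) (A \<times> B)"
proof (rule has_sum_SigmaI)
  show "((\<lambda>y. case (x, y) of (x, y) \<Rightarrow> f x * g y) has_sum f x * t) B" for x
    using has_sum_cmult_right[OF g(2)] by simp
  show "((\<lambda>x. f x * t) has_sum s * t) A"
    by (rule has_sum_cmult_left[OF f(2)])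
  show "(\<lambda>(x, y). f x * g y) summable_on A \<times> B"
    by (rule abs_summable_summable[OF abs_summable_on_Times[OF f(1) g(1)]])
qed

text \<open>Pairs are reindexed by \<open>(m + n, m)\<close>, so that a double series with weights
  \<open>s ^ (m + n)\<close> becomes a power series in \<open>s\<close>.\<close>

lemma has_sum_diagonals:
  fixes T :: "nat \<times> nat \<Rightarrow> 'a :: {topological_comm_monoid_add, t3_space}"
  assumes "(T has_sum S) UNIV"
  shows "((\<lambda>N. \<Sum>m\<le>N. T (m, N - m)) has_sum S) UNIV"
proof -
  have "((\<lambda>(N, m). T (m, N - m)) has_sum S) (SIGMA N:UNIV. {..N}) \<longleftrightarrow> (T has_sum S) UNIV"
    by (rule has_sum_reindex_bij_witness[of _ "\<lambda>(m, n). (m + n, m)" "\<lambda>(N, m). (m, N - m)"]) auto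
  hence "((\<lambda>(N, m). T (m, N - m)) has_sum S) (SIGMA N:UNIV. {..N})"
    using assms by simp
  from has_sum_SigmaD[OF this] show ?thesis by simp
qed

section \<open>Basic identities and auxiliary functions\<close>

lemma qpoch_0 [simp]: "qpoch a q 0 = 1"
  by (simp add: qpoch_def)

lemma qpoch_Suc: "qpoch a q (Suc n) = qpoch a q n * (1 - a * q ^ n)"
  by (simp add: qpoch_def)

lemma qpoch_inf_0 [simp]: "qpoch_inf 0 q = 1"
  by (simp add: qpoch_inf_def)

definition qweight :: "complex \<Rightarrow> complex \<Rightarrow> complex \<Rightarrow> complex \<Rightarrow> complex" where
  "qweight q u v x = qpoch_inf (q * x / u) q * qpoch_inf (q * x / v) q"

text \<open>Here \<open>x\<close> is an endpoint, not the integration variable: this is its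
  contribution to the Jackson integral of \<open>y ^ N * qweight q u v y\<close>, without the factor
  \<open>1 - q\<close>. The moment over the interval is the value at \<open>v\<close> minus the
  value at \<open>u\<close>.\<close>

definition qmoment :: "complex \<Rightarrow> complex \<Rightarrow> complex \<Rightarrow> complex \<Rightarrow> nat \<Rightarrow> complex" where
  "qmoment q u v x N = x * (\<Sum>n. (x * q ^ n) ^ N * qweight q u v (x * q ^ n) * q ^ n)"

lemma hom_rogers_szego_0 [simp]: "hom_rogers_szego 0 u v q = 1"
  by (simp add: hom_rogers_szego_def qbinom_def)

text \<open>The integrand divided by \<open>qweight\<close>. For small \<open>x\<close> it is the
  product of the generating functions of the two families of Hahn polynomials.\<close>

definition hahn_kernel ::
    "complex \<Rightarrow> complex \<Rightarrow> complex \<Rightarrow> complex \<Rightarrow> complex \<Rightarrow> complex \<Rightarrow> complex \<Rightarrow> complex \<Rightarrow> complex" where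
  "hahn_kernel q \<alpha> \<beta> a b c d x =
     qpochs_inf [\<alpha> * a * x, \<beta> * c * x] q / qpochs_inf [a * x, b * x, c * x, d * x] q"

text \<open>The Jackson sum of \<open>qweight\<close> times \<open>hahn_kernel\<close> over \<open>x q\<^sup>n\<close>, multiplied by the denominator of \<open>hahn_kernel\<close>
  at \<open>x\<close>: unlike the sum itself it has no poles in \<open>a, b, c, d\<close>.\<close>

definition hahn_numerator ::
    "complex \<Rightarrow> complex \<Rightarrow> complex \<Rightarrow> complex \<Rightarrow> complex \<Rightarrow> complex \<Rightarrow> complex \<Rightarrow> complex \<Rightarrow> complex \<Rightarrow> complex \<Rightarrow> complex" where
  "hahn_numerator q \<alpha> \<beta> a b c d u v x = x * (\<Sum>n. (qweight q u v (x * q ^ n) *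
     (qpoch_inf (\<alpha> * a * (x * q ^ n)) q * (qpoch_inf (\<beta> * c * (x * q ^ n)) q *
     (qpoch (a * x) q n * (qpoch (b * x) q n * (qpoch (c * x) q n * qpoch (d * x) q n)))))) * q ^ n)"

text \<open>The boundedness hypothesis of \<open>holomorphic_suminf_qpow\<close>, named because it
  is stable under products and so can be checked factor by factor for the summands of
  \<open>hahn_numerator\<close>.\<close>

definition locally_bounded_seq :: "(nat \<Rightarrow> complex \<Rightarrow> complex) \<Rightarrow> bool" where
  "locally_bounded_seq g \<longleftrightarrow> (\<forall>R. \<exists>K. \<forall>n z. norm z \<le> R \<longrightarrow> norm (g n z) \<le> K)"

lemma locally_bounded_seq_mult:
  assumes "locally_bounded_seq f" "locally_bounded_seq g"
  shows "locally_bounded_seq (\<lambda>n z. f n z * g n z)"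
  unfolding locally_bounded_seq_def
proof
  fix R
  obtain K L where K: "\<And>n z. norm z \<le> R \<Longrightarrow> norm (f n z) \<le> K" and L: "\<And>n z. norm z \<le> R \<Longrightarrow> norm (g n z) \<le> L"
    using assms unfolding locally_bounded_seq_def by metis
  show "\<exists>K. \<forall>n z. norm z \<le> R \<longrightarrow> norm (f n z * g n z) \<le> K"
    by (rule exI[of _ "K * L"]) (auto simp: norm_mult intro!: mult_mono K L order.trans[OF norm_ge_zero K])
qed

text \<open>Every summand is homogeneous of degree \<open>m\<close> in \<open>a\<close> and
  \<open>b\<close>. Scaling all parameters therefore only inserts powers of \<open>s\<close> into
  the double series.\<close>

lemma hom_hahn_scale: "hom_hahn \<alpha> m (s * a) (s * b) q = s ^ m * hom_hahn \<alpha> m a b q"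
  unfolding hom_hahn_def sum_distrib_left
proof (intro sum.cong refl)
  fix k assume "k \<in> {..m}"
  hence "s ^ m = s ^ k * s ^ (m - k)" by (simp flip: power_add)
  thus "qbinom q m k * qpoch \<alpha> q k * (s * a) ^ k * (s * b) ^ (m - k) =
      s ^ m * (qbinom q m k * qpoch \<alpha> q k * a ^ k * b ^ (m - k))"
    by (simp add: power_mult_distrib)
qed

text \<open>All \<open>qpoch 0 q k\<close> equal 1; generating functions of Hahn polynomials thus
  specialise to Rogers-Szego polynomials.\<close>

lemma hom_hahn_0: "hom_hahn 0 n x y q = hom_rogers_szego n x y q"
  by (simp add: hom_hahn_def hom_rogers_szego_def qpoch_def[of 0])

definition hahn_term ::
    "complex \<Rightarrow> complex \<Rightarrow> complex \<Rightarrow> complex \<Rightarrow> complex \<Rightarrow> complex \<Rightarrow> complex \<Rightarrow> complex \<Rightarrow> complex \<Rightarrow> nat \<times> nat \<Rightarrow> complex" where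
  "hahn_term q \<alpha> \<beta> a b c d u v = (\<lambda>(m, n). hom_hahn \<alpha> m a b q * hom_hahn \<beta> n c d q *
     (hom_rogers_szego (m + n) u v q / (qpoch q q m * qpoch q q n)))"

lemma hahn_term_scale:
  "hahn_term q \<alpha> \<beta> (s * a) (s * b) (s * c) (s * d) u v (m, n) =
     hahn_term q \<alpha> \<beta> a b c d u v (m, n) * s ^ (m + n)"
  by (simp add: hahn_term_def hom_hahn_scale power_add)

subsection \<open>Shifted factorials and the \<open>q\<close>-binomial theorem\<close>

context
  fixes q :: complex
  assumes q: "norm q < 1"
begin

lemma summable_norm_qpow: "summable (\<lambda>n. norm q ^ n)"
  using q by (simp add: summable_geometric)

lemma norm_qpow_le_1: "norm q ^ n \<le> 1"
  using q by (simp add: power_le_one)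

lemma qpow_tendsto_0: "(\<lambda>n. q ^ n) \<longlonglongrightarrow> 0"
  using q by (rule LIMSEQ_power_zero)

lemma one_minus_qpow_ne_0:
  assumes "norm z < 1" shows "1 - z * q ^ k \<noteq> 0"
proof -
  have "norm (z * q ^ k) \<le> norm z * 1"
    unfolding norm_mult norm_power by (intro mult_left_mono norm_qpow_le_1) auto
  thus ?thesis using assms by (intro one_minus_ne_0) simp
qed

lemma qpoch_nonzero: "norm z < 1 \<Longrightarrow> qpoch z q n \<noteq> 0"
  using one_minus_qpow_ne_0[of z] by (simp add: qpoch_def)

lemma qpoch_convergent_prod: "convergent_prod (\<lambda>k. 1 - a * q ^ k)"
proof -
  have "summable (\<lambda>k. norm (- a * q ^ k))"
    using summable_mult[OF summable_norm_qpow, of "norm a"] by (simp add: norm_mult norm_power)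
  hence "abs_convergent_prod (\<lambda>k. 1 + (- a * q ^ k))"
    by (intro summable_imp_abs_convergent_prod) simp
  from abs_convergent_prod_imp_convergent_prod[OF this] show ?thesis by simp
qed

lemma qpoch_LIMSEQ: "(\<lambda>n. qpoch a q n) \<longlonglongrightarrow> qpoch_inf a q"
proof -
  have "(\<lambda>n. \<Prod>k\<le>n. 1 - a * q ^ k) \<longlonglongrightarrow> qpoch_inf a q"
    unfolding qpoch_inf_def by (rule convergent_prod_LIMSEQ[OF qpoch_convergent_prod])
  hence "(\<lambda>n. qpoch a q (Suc n)) \<longlonglongrightarrow> qpoch_inf a q"
    by (simp add: qpoch_def lessThan_Suc_atMost)
  thus ?thesis by (subst (asm) filterlim_sequentially_Suc)
qed

text \<open>The inequality \<open>1 + t \<le> exp t\<close> turns the product into the exponential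
  of a geometric sum, so the bound does not depend on \<open>n\<close>.\<close>

lemma norm_qpoch_le: "norm (qpoch a q n) \<le> exp (norm a / (1 - norm q))"
proof -
  have "norm (qpoch a q n) = (\<Prod>k<n. norm (1 - a * q ^ k))"
    by (simp add: qpoch_def prod_norm)
  also have "\<dots> \<le> (\<Prod>k<n. exp (norm a * norm q ^ k))"
  proof (intro prod_mono conjI norm_ge_zero)
    fix k
    have "norm (1 - a * q ^ k) \<le> 1 + norm a * norm q ^ k"
      using norm_triangle_ineq4[of 1 "a * q ^ k"] by (simp add: norm_mult norm_power)
    also have "\<dots> \<le> exp (norm a * norm q ^ k)" by (rule exp_ge_add_one_self)
    finally show "norm (1 - a * q ^ k) \<le> exp (norm a * norm q ^ k)" .
  qed
  also have "\<dots> = exp (norm a * (\<Sum>k<n. norm q ^ k))"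
    by (simp add: exp_sum sum_distrib_left)
  also have "\<dots> \<le> exp (norm a * (1 / (1 - norm q)))"
  proof -
    have "(\<Sum>k<n. norm q ^ k) \<le> (\<Sum>k. norm q ^ k)"
      by (intro sum_le_suminf summable_norm_qpow) auto
    also have "\<dots> = 1 / (1 - norm q)" using q by (simp add: suminf_geometric)
    finally show ?thesis by (simp only: exp_le_cancel_iff mult_left_mono norm_ge_zero)
  qed
  finally show ?thesis by simp
qed

lemma norm_qpoch_inf_le: "norm (qpoch_inf a q) \<le> exp (norm a / (1 - norm q))"
  by (rule LIMSEQ_le_const2[OF tendsto_norm[OF qpoch_LIMSEQ]]) (use norm_qpoch_le in auto)

lemma bounded_qpoch: "norm a \<le> R \<Longrightarrow> norm (qpoch a q n) \<le> exp (R / (1 - norm q))"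
  using q by (intro order.trans[OF norm_qpoch_le]) (auto intro!: divide_right_mono)

lemma bounded_qpoch_inf: "norm a \<le> R \<Longrightarrow> norm (qpoch_inf a q) \<le> exp (R / (1 - norm q))"
  using q by (intro order.trans[OF norm_qpoch_inf_le]) (auto intro!: divide_right_mono)

lemma qpoch_add: "qpoch a q (n + m) = qpoch a q n * qpoch (a * q ^ n) q m"
  by (induction m) (auto simp: qpoch_Suc power_add algebra_simps)

lemma qpoch_inf_split: "qpoch_inf a q = qpoch a q n * qpoch_inf (a * q ^ n) q"
proof -
  have "(\<lambda>m. qpoch a q (m + n)) \<longlonglongrightarrow> qpoch_inf a q"
    using qpoch_LIMSEQ by (rule LIMSEQ_ignore_initial_segment)
  moreover have "(\<lambda>m. qpoch a q (m + n)) \<longlonglongrightarrow> qpoch a q n * qpoch_inf (a * q ^ n) q"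
    unfolding add.commute[of _ n] qpoch_add by (intro tendsto_intros qpoch_LIMSEQ)
  ultimately show ?thesis by (rule LIMSEQ_unique)
qed

lemma qpoch_inf_Suc: "qpoch_inf a q = (1 - a) * qpoch_inf (a * q) q"
  using qpoch_inf_split[of a 1] by (simp add: qpoch_def)

lemma qpoch_inf_1 [simp]: "qpoch_inf 1 q = 0"
  by (subst qpoch_inf_Suc) simp

lemma qpoch_inf_nonzero:
  assumes "\<And>k. 1 - a * q ^ k \<noteq> 0" shows "qpoch_inf a q \<noteq> 0"
  unfolding qpoch_inf_def using assms by (intro prodinf_nonzero qpoch_convergent_prod)

lemma qpoch_inf_nonzero': "norm a < 1 \<Longrightarrow> qpoch_inf a q \<noteq> 0"
  by (intro qpoch_inf_nonzero one_minus_qpow_ne_0)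

section \<open>Series in powers of \<open>q\<close> and holomorphy in the parameters\<close>

lemma summable_qpow_mult:
  assumes "\<And>n. norm (c n) \<le> K"
  shows "summable (\<lambda>n. norm (c n * q ^ n))"
proof (rule summable_comparison_test')
  show "summable (\<lambda>n. K * norm q ^ n)" by (intro summable_mult summable_norm_qpow)
  show "norm (norm (c n * q ^ n)) \<le> K * norm q ^ n" if "n \<ge> 0" for n
    using assms[of n] by (auto simp: norm_mult norm_power intro!: mult_right_mono)
qed

text \<open>Weierstrass M-test on the closed unit disc about each point; the factor
  \<open>q ^ n\<close> supplies the geometric majorant.\<close>

lemma holomorphic_suminf_qpow:
  assumes hol: "\<And>n. g n holomorphic_on UNIV"
    and bd: "\<And>R. \<exists>K. \<forall>n z. norm z \<le> R \<longrightarrow> norm (g n z) \<le> K"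
  shows "(\<lambda>z. \<Sum>n. g n z * q ^ n) holomorphic_on UNIV"
proof (rule holomorphic_uniform_sequence)
  show "open (UNIV :: complex set)" by simp
  show "(\<lambda>z. \<Sum>i<n. g i z * q ^ i) holomorphic_on UNIV" for n
    by (intro holomorphic_intros hol)
  fix x :: complex
  obtain K where K: "\<And>n z. norm z \<le> norm x + 1 \<Longrightarrow> norm (g n z) \<le> K"
    using bd by blast
  have "uniform_limit (cball x 1) (\<lambda>n z. \<Sum>i<n. g i z * q ^ i) (\<lambda>z. \<Sum>n. g n z * q ^ n) sequentially"
  proof (rule Weierstrass_m_test)
    show "summable (\<lambda>n. K * norm q ^ n)" by (intro summable_mult summable_norm_qpow)
    fix n z assume "z \<in> cball x 1"
    hence "norm z \<le> norm x + 1"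
      using norm_triangle_ineq2[of z x] by (simp add: dist_norm norm_minus_commute)
    thus "norm (g n z * q ^ n) \<le> K * norm q ^ n"
      using K by (auto simp: norm_mult norm_power intro!: mult_right_mono)
  qed
  thus "\<exists>d>0. cball x d \<subseteq> UNIV \<and>
      uniform_limit (cball x d) (\<lambda>n z. \<Sum>i<n. g i z * q ^ i) (\<lambda>z. \<Sum>n. g n z * q ^ n) sequentially"
    by (intro exI[of _ 1]) auto
qed

text \<open>The partial products telescope. The infinite product becomes a series to which
  \<open>holomorphic_suminf_qpow\<close> applies.\<close>

lemma qpoch_inf_eq_suminf: "qpoch_inf a q = 1 + (\<Sum>n. (- a * qpoch a q n) * q ^ n)"
proof -
  have "(\<lambda>n. qpoch a q (Suc n) - qpoch a q n) sums (qpoch_inf a q - qpoch a q 0)"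
    by (intro telescope_sums qpoch_LIMSEQ)
  also have "(\<lambda>n. qpoch a q (Suc n) - qpoch a q n) = (\<lambda>n. (- a * qpoch a q n) * q ^ n)"
    by (auto simp: qpoch_Suc algebra_simps)
  finally show ?thesis by (simp add: sums_iff)
qed

lemma holomorphic_qpoch [holomorphic_intros]:
  "f holomorphic_on S \<Longrightarrow> (\<lambda>z. qpoch (f z) q n) holomorphic_on S"
  unfolding qpoch_def by (intro holomorphic_intros)

lemma holomorphic_qpoch_inf_UNIV: "(\<lambda>z. qpoch_inf z q) holomorphic_on UNIV"
  unfolding qpoch_inf_eq_suminf
proof (intro holomorphic_intros holomorphic_suminf_qpow)
  fix R :: real
  show "\<exists>K. \<forall>n z. norm z \<le> R \<longrightarrow> norm (- z * qpoch z q n) \<le> K"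
  proof (intro exI allI impI)
    fix n and z :: complex assume z: "norm z \<le> R"
    show "norm (- z * qpoch z q n) \<le> R * exp (R / (1 - norm q))"
      unfolding norm_mult norm_minus_cancel
      using z order.trans[OF norm_ge_zero z] by (intro mult_mono bounded_qpoch) auto
  qed
qed

lemma holomorphic_qpoch_inf [holomorphic_intros]:
  assumes "f holomorphic_on S" shows "(\<lambda>z. qpoch_inf (f z) q) holomorphic_on S"
  using holomorphic_on_compose_gen[OF assms holomorphic_qpoch_inf_UNIV] by (simp add: o_def)

lemma tendsto_qpoch_inf [tendsto_intros]:
  assumes "(f \<longlongrightarrow> a) F" shows "((\<lambda>x. qpoch_inf (f x) q) \<longlongrightarrow> qpoch_inf a q) F"
proof -
  have "isCont (\<lambda>z. qpoch_inf z q) a"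
    using holomorphic_on_imp_continuous_on[OF holomorphic_qpoch_inf_UNIV]
    by (simp add: continuous_on_eq_continuous_at)
  thus ?thesis using assms by (rule isCont_tendsto_compose)
qed

section \<open>The \<open>q\<close>-binomial series and its sum\<close>

lemma bounded_qpoch_ratio: "\<exists>K. \<forall>k. norm (qpoch a q k / qpoch q q k) \<le> K"
proof -
  have "convergent (\<lambda>k. qpoch a q k / qpoch q q k)"
    unfolding convergent_def using qpoch_inf_nonzero'[OF q] by (blast intro: tendsto_intros qpoch_LIMSEQ)
  hence "Bseq (\<lambda>k. qpoch a q k / qpoch q q k)" by (rule convergent_imp_Bseq)
  thus ?thesis by (auto simp: Bseq_def)
qed

lemma qbinomial_summable:
  assumes z: "norm z < 1"
  shows "summable (\<lambda>k. norm (qpoch a q k / qpoch q q k * z ^ k))"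
proof -
  obtain K where K: "\<And>k. norm (qpoch a q k / qpoch q q k) \<le> K" using bounded_qpoch_ratio by blast
  show ?thesis
  proof (rule summable_comparison_test')
    show "summable (\<lambda>k. K * norm z ^ k)" using z by (intro summable_mult summable_geometric) auto
    show "norm (norm (qpoch a q n / qpoch q q n * z ^ n)) \<le> K * norm z ^ n" if "n \<ge> 0" for n
      using K[of n] unfolding norm_mult norm_power real_norm_def abs_norm_cancel
      by (auto intro!: mult_right_mono)
  qed
qed

text \<open>The series \<open>F\<close> satisfies
  \<open>(1 - w) * F w = (1 - a * w) * F (w * q)\<close>. Iteration produces the finite products,
  and in the limit the argument \<open>z * q ^ n\<close> tends to 0, where \<open>F\<close> is
  continuous with value 1.\<close>

theorem qbinomial_sums:
  assumes z: "norm z < 1"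
  shows "(\<lambda>k. qpoch a q k / qpoch q q k * z ^ k) sums (qpoch_inf (a * z) q / qpoch_inf z q)"
proof -
  define c where "c = (\<lambda>k. qpoch a q k / qpoch q q k)"
  define F where "F = (\<lambda>z. \<Sum>k. c k * z ^ k)"
  have sm: "summable (\<lambda>k. c k * w ^ k)" if "norm w < 1" for w
    unfolding c_def by (rule summable_norm_cancel[OF qbinomial_summable[OF that]])
  \<comment> \<open>The ratio of consecutive coefficients; multiplied by \<open>w ^ Suc k\<close>
    and summed, it gives the functional equation.\<close>
  have step: "c (Suc k) * (1 - q ^ Suc k) = c k * (1 - a * q ^ k)" for k
    using one_minus_qpow_ne_0[OF q, of k] qpoch_nonzero[OF q, of k]
    by (simp add: c_def qpoch_Suc field_simps)
  have feq: "(1 - w) * F w = (1 - a * w) * F (w * q)" if w: "norm w < 1" for w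
  proof -
    have wq: "norm (w * q) < 1"
      using w q mult_left_le[of "norm q" "norm w"] by (simp add: norm_mult)
    have 1: "(\<lambda>k. c k * (1 - q ^ k) * w ^ k) sums (F w - F (w * q))"
      using sums_diff[OF summable_sums[OF sm[OF w]] summable_sums[OF sm[OF wq]]]
      by (simp add: F_def algebra_simps power_mult_distrib)
    have 2: "(\<lambda>k. w * (c k * (1 - a * q ^ k) * w ^ k)) sums (w * (F w - a * F (w * q)))"
      using sums_mult[OF sums_diff[OF summable_sums[OF sm[OF w]] sums_mult[OF summable_sums[OF sm[OF wq]], of a]], of w]
      by (simp add: F_def algebra_simps power_mult_distrib)
    \<comment> \<open>The term for \<open>k = 0\<close> carries the factor
      \<open>1 - q ^ 0 = 0\<close>, so dropping it leaves the sum unchanged.\<close>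
    have "(\<lambda>k. c (Suc k) * (1 - q ^ Suc k) * w ^ Suc k) sums (F w - F (w * q))"
      using 1 by (subst sums_Suc_iff) simp
    also have "(\<lambda>k. c (Suc k) * (1 - q ^ Suc k) * w ^ Suc k) = (\<lambda>k. w * (c k * (1 - a * q ^ k) * w ^ k))"
      unfolding step by (simp add: algebra_simps)
    finally have "F w - F (w * q) = w * (F w - a * F (w * q))"
      using 2 sums_unique2 by blast
    thus ?thesis by (simp add: algebra_simps)
  qed
  have zq: "norm (z * q ^ n) < 1" for n
    using z norm_qpow_le_1[of n] mult_left_le[of "norm q ^ n" "norm z"] by (simp add: norm_mult norm_power)
  have iter: "qpoch z q n * F z = qpoch (a * z) q n * F (z * q ^ n)" for n
  proof (induction n)
    case (Suc n)
    have "qpoch z q (Suc n) * F z = (1 - z * q ^ n) * (qpoch z q n * F z)"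
      by (simp add: qpoch_Suc)
    also have "\<dots> = qpoch (a * z) q n * ((1 - z * q ^ n) * F (z * q ^ n))"
      by (simp add: Suc)
    also have "\<dots> = qpoch (a * z) q (Suc n) * F (z * q ^ Suc n)"
      unfolding feq[OF zq] by (simp add: qpoch_Suc mult_ac)
    finally show ?case .
  qed auto
  have "isCont F 0"
    unfolding F_def by (rule isCont_powser[where K = "1/2"]) (auto intro!: sm)
  moreover have "(\<lambda>n. z * q ^ n) \<longlonglongrightarrow> 0"
    using tendsto_mult_left[OF qpow_tendsto_0, of z] by simp
  ultimately have "(\<lambda>n. F (z * q ^ n)) \<longlonglongrightarrow> F 0" by (rule isCont_tendsto_compose)
  moreover have "F 0 = 1" using powser_zero[of c] by (simp add: F_def c_def)
  ultimately have "(\<lambda>n. qpoch (a * z) q n * F (z * q ^ n)) \<longlonglongrightarrow> qpoch_inf (a * z) q * 1"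
    by (intro tendsto_mult qpoch_LIMSEQ) simp
  moreover have "(\<lambda>n. qpoch (a * z) q n * F (z * q ^ n)) \<longlonglongrightarrow> qpoch_inf z q * F z"
    unfolding iter[symmetric] by (intro tendsto_mult qpoch_LIMSEQ tendsto_const)
  ultimately have "qpoch_inf (a * z) q = qpoch_inf z q * F z"
    using LIMSEQ_unique by fastforce
  hence "F z = qpoch_inf (a * z) q / qpoch_inf z q"
    using qpoch_inf_nonzero'[OF z] by (simp add: field_simps)
  thus ?thesis using summable_sums[OF sm[OF z]] by (simp add: F_def c_def)
qed

subsection \<open>Moments of the weight\<close>

lemma norm_mult_qpow_le: "norm (x * q ^ n) \<le> norm x"
  using mult_left_le[OF norm_qpow_le_1[of n], of "norm x"] by (simp add: norm_mult norm_power)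

lemma entire_bounded_qpow:
  assumes "f holomorphic_on UNIV"
  shows "\<exists>K. \<forall>n. norm (f (x * q ^ n) :: complex) \<le> K"
  using entire_bounded[OF assms, of "norm x"] norm_mult_qpow_le by blast

lemma entire_summable_qpow:
  assumes "f holomorphic_on UNIV"
  shows "summable (\<lambda>n. norm (f (x * q ^ n) * q ^ n))"
  using entire_bounded_qpow[OF assms, of x] summable_qpow_mult[of "\<lambda>n. f (x * q ^ n)"] by blast

lemma mult_qpow_tendsto_0: "(\<lambda>n. x * q ^ n) \<longlonglongrightarrow> 0"
  using tendsto_mult_left[OF qpow_tendsto_0, of x] by simp

lemma holomorphic_qweight: "qweight q u v holomorphic_on UNIV"
  unfolding qweight_def[abs_def] divide_inverse by (intro holomorphic_intros)

lemma qmoment_sums: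
  "(\<lambda>n. x * ((x * q ^ n) ^ N * qweight q u v (x * q ^ n) * q ^ n)) sums qmoment q u v x N"
  unfolding qmoment_def
proof (rule sums_mult[OF summable_sums[OF summable_norm_cancel]])
  have "(\<lambda>x. x ^ N * qweight q u v x) holomorphic_on UNIV"
    by (intro holomorphic_intros holomorphic_qweight)
  from entire_summable_qpow[OF this]
  show "summable (\<lambda>n. norm ((x * q ^ n) ^ N * qweight q u v (x * q ^ n) * q ^ n))" by simp
qed

text \<open>The telescoping sum behind \<open>q\<close>-integration by parts.\<close>

lemma qweight_telescope:
  assumes "u \<noteq> 0" "v \<noteq> 0" "x \<in> {u, v}"
  shows "(\<lambda>n. (x * q ^ n) ^ N * qweight q u v (x * q ^ n) *
           ((1 - x * q ^ n / u) * (1 - x * q ^ n / v) - q ^ N)) sums (- (0 ^ N))"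
proof -
  define g where "g = (\<lambda>y. y ^ N * (qpoch_inf (y / u) q * qpoch_inf (y / v) q))"
  have "((\<lambda>n. g (x * q ^ n)) \<longlongrightarrow> 0 ^ N * (qpoch_inf (0 / u) q * qpoch_inf (0 / v) q)) sequentially"
    unfolding g_def using assms by (intro tendsto_intros mult_qpow_tendsto_0) auto
  \<comment> \<open>Since \<open>0 ^ 0 = 1\<close>, a boundary term survives exactly for
    \<open>N = 0\<close>.\<close>
  hence "(\<lambda>n. g (x * q ^ n)) \<longlonglongrightarrow> 0 ^ N" by simp
  hence "(\<lambda>n. g (x * q ^ n) - g (x * q ^ Suc n)) sums (g (x * q ^ 0) - 0 ^ N)"
    by (rule telescope_sums')
  \<comment> \<open>At an endpoint one of \<open>x / u\<close> and \<open>x / v\<close> is 1, and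
    \<open>qpoch_inf 1 q = 0\<close>.\<close>
  moreover have "g (x * q ^ 0) = 0"
    using assms qpoch_inf_1 by (auto simp: g_def)
  \<comment> \<open>For \<open>y = x * q ^ n\<close>, the value \<open>g (q * y)\<close> is
    \<open>(q * y) ^ N\<close> times the weight at \<open>y\<close>, while \<open>g y\<close> is
    \<open>y ^ N\<close> times the weight and the two split-off factors \<open>1 - y / u\<close> and
    \<open>1 - y / v\<close>.\<close>
  moreover have "g (x * q ^ n) - g (x * q ^ Suc n) = (x * q ^ n) ^ N * qweight q u v (x * q ^ n) *
           ((1 - x * q ^ n / u) * (1 - x * q ^ n / v) - q ^ N)" for n
  proof -
    have 1: "qpoch_inf (x * q ^ n / w) q = (1 - x * q ^ n / w) * qpoch_inf (q * (x * q ^ n) / w) q" for w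
      by (subst qpoch_inf_Suc) (simp add: mult_ac)
    show ?thesis unfolding g_def 1 qweight_def
      by (simp add: algebra_simps power_mult_distrib)
  qed
  ultimately show ?thesis by simp
qed

text \<open>Telescoping with exponent \<open>Suc N\<close>, where the boundary term vanishes. One
  power of \<open>y = x * q ^ n\<close> supplies the measure \<open>x * q ^ n\<close> of the Jackson
  sum; the quadratic factor times \<open>u * v\<close> yields the three coefficients.\<close>

lemma qmoment_rec:
  assumes "u \<noteq> 0" "v \<noteq> 0" "x \<in> {u, v}"
  shows "qmoment q u v x (Suc (Suc N)) =
           (u + v) * qmoment q u v x (Suc N) - u * v * (1 - q ^ Suc N) * qmoment q u v x N"
proof -
  let ?t = "\<lambda>N n. x * ((x * q ^ n) ^ N * qweight q u v (x * q ^ n) * q ^ n)"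
  have "(\<lambda>n. u * v * (1 - q ^ Suc N) * ?t N n - (u + v) * ?t (Suc N) n + ?t (Suc (Suc N)) n) sums
     (u * v * (1 - q ^ Suc N) * qmoment q u v x N - (u + v) * qmoment q u v x (Suc N)
       + qmoment q u v x (Suc (Suc N)))"
    by (intro sums_add sums_diff sums_mult qmoment_sums)
  moreover have "(\<lambda>n. u * v * ((x * q ^ n) ^ Suc N * qweight q u v (x * q ^ n) *
           ((1 - x * q ^ n / u) * (1 - x * q ^ n / v) - q ^ Suc N))) sums (u * v * (- (0 ^ Suc N)))"
    by (intro sums_mult qweight_telescope assms)
  moreover have "u * v * ((x * q ^ n) ^ Suc N * qweight q u v (x * q ^ n) *
           ((1 - x * q ^ n / u) * (1 - x * q ^ n / v) - q ^ Suc N)) =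
      u * v * (1 - q ^ Suc N) * ?t N n - (u + v) * ?t (Suc N) n + ?t (Suc (Suc N)) n" for n
  proof -
    have "u * v * ((1 - y / u) * (1 - y / v) - r) = u * v * (1 - r) - (u + v) * y + y * y" for y r
      using assms by (simp add: field_simps)
    moreover have "u * v * ((x * q ^ n) ^ Suc N * w * z) = (x * q ^ n) ^ Suc N * w * (u * v * z)" for w z
      by (simp only: mult_ac)
    ultimately show ?thesis by (simp only:) (simp add: algebra_simps)
  qed
  ultimately have "u * v * (1 - q ^ Suc N) * qmoment q u v x N - (u + v) * qmoment q u v x (Suc N)
       + qmoment q u v x (Suc (Suc N)) = u * v * (- (0 ^ Suc N))"
    using sums_unique2 by (metis (no_types, lifting) sums_cong)
  thus ?thesis by (simp add: algebra_simps)
qed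

text \<open>Telescoping with exponent 0. The constant term of the quadratic factor cancels against
  \<open>q ^ 0\<close>, which again leaves a power of \<open>y\<close> for the measure, and the
  boundary term contributes \<open>- u * v\<close> at either endpoint.\<close>

lemma qmoment_1:
  assumes "u \<noteq> 0" "v \<noteq> 0" "x \<in> {u, v}"
  shows "qmoment q u v x 1 = (u + v) * qmoment q u v x 0 - u * v"
proof -
  let ?t = "\<lambda>N n. x * ((x * q ^ n) ^ N * qweight q u v (x * q ^ n) * q ^ n)"
  have "(\<lambda>n. ?t 1 n - (u + v) * ?t 0 n) sums (qmoment q u v x 1 - (u + v) * qmoment q u v x 0)"
    by (intro sums_diff sums_mult qmoment_sums)
  moreover have "(\<lambda>n. u * v * ((x * q ^ n) ^ 0 * qweight q u v (x * q ^ n) *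
           ((1 - x * q ^ n / u) * (1 - x * q ^ n / v) - q ^ 0))) sums (u * v * (- (0 ^ 0)))"
    by (intro sums_mult qweight_telescope assms)
  moreover have "u * v * ((x * q ^ n) ^ 0 * qweight q u v (x * q ^ n) *
           ((1 - x * q ^ n / u) * (1 - x * q ^ n / v) - q ^ 0)) = ?t 1 n - (u + v) * ?t 0 n" for n
  proof -
    have "u * v * (w * ((1 - y / u) * (1 - y / v) - 1)) = w * (- (u + v) * y + y * y)" for y w
      using assms by (simp add: field_simps)
    from this[of "qweight q u v (x * q ^ n)" "x * q ^ n"] show ?thesis by (simp add: algebra_simps)
  qed
  ultimately have "qmoment q u v x 1 - (u + v) * qmoment q u v x 0 = u * v * (- (0 ^ 0))"
    using sums_unique2 by (metis (no_types, lifting) sums_cong)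
  thus ?thesis by (simp add: algebra_simps)
qed

section \<open>Recurrence and growth of the Rogers-Szego polynomials\<close>

lemma hom_rogers_szego_convolution:
  "hom_rogers_szego N u v q = qpoch q q N * (\<Sum>k\<le>N. u ^ k / qpoch q q k * (v ^ (N - k) / qpoch q q (N - k)))"
  by (simp add: hom_rogers_szego_def qbinom_def sum_distrib_left mult.assoc)

text \<open>Divided by \<open>qpoch q q N\<close>, the polynomials become convolutions
  \<open>e N\<close> of the sequences \<open>p u\<close> and \<open>p v\<close>. Each of these obeys
  a one-step recurrence, and applying one after the other gives a two-step recurrence for
  \<open>e\<close>.\<close>

lemma hom_rogers_szego_rec:
  "hom_rogers_szego 1 u v q = u + v"
  "hom_rogers_szego (Suc (Suc N)) u v q =
     (u + v) * hom_rogers_szego (Suc N) u v q - u * v * (1 - q ^ Suc N) * hom_rogers_szego N u v q"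
proof -
  define p where "p = (\<lambda>w k. w ^ k / qpoch q q k)"
  define e where "e = (\<lambda>N. \<Sum>k\<le>N. p u k * p v (N - k))"
  have h: "hom_rogers_szego N u v q = qpoch q q N * e N" for N
    by (simp add: hom_rogers_szego_convolution e_def p_def)
  have p: "(1 - q ^ Suc k) * p w (Suc k) = w * p w k" for w k
    using one_minus_qpow_ne_0[OF q, of k] qpoch_nonzero[OF q, of k]
    by (simp add: p_def qpoch_Suc field_simps)
  have X: "(\<Sum>k\<le>Suc N. (1 - q ^ k) * p u k * p v (Suc N - k)) = u * e N" for N
    unfolding sum.atMost_Suc_shift p by (simp add: e_def sum_distrib_left mult_ac)
  have Y: "(\<Sum>k\<le>Suc N. q ^ k * p u k * ((1 - q ^ (Suc N - k)) * p v (Suc N - k))) =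
             v * (\<Sum>k\<le>N. q ^ k * p u k * p v (N - k))" for N
    unfolding sum.atMost_Suc sum_distrib_left
    by (simp add: Suc_diff_le p del: power_Suc) (simp add: mult_ac)
  have E: "(1 - q ^ Suc N) * e (Suc N) = u * e N + v * (\<Sum>k\<le>N. q ^ k * p u k * p v (N - k))" for N
  proof -
    \<comment> \<open>Split \<open>1 - q ^ Suc N\<close> as
      \<open>(1 - q ^ k) + q ^ k * (1 - q ^ (Suc N - k))\<close>: the first part lowers the index of
      \<open>p u\<close>, the second that of \<open>p v\<close>.\<close>
    have "(1 - q ^ Suc N) * e (Suc N) = (\<Sum>k\<le>Suc N. (1 - q ^ k) * p u k * p v (Suc N - k) +
            q ^ k * p u k * ((1 - q ^ (Suc N - k)) * p v (Suc N - k)))"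
      unfolding e_def sum_distrib_left
    proof (rule sum.cong[OF refl])
      fix k assume "k \<in> {..Suc N}"
      hence "q ^ Suc N = q ^ k * q ^ (Suc N - k)" by (simp flip: power_add)
      thus "(1 - q ^ Suc N) * (p u k * p v (Suc N - k)) = (1 - q ^ k) * p u k * p v (Suc N - k) +
            q ^ k * p u k * ((1 - q ^ (Suc N - k)) * p v (Suc N - k))"
        by (simp only:) (simp add: algebra_simps)
    qed
    thus ?thesis unfolding sum.distrib X Y .
  qed
  show "hom_rogers_szego 1 u v q = u + v"
    using E[of 0] by (simp add: h e_def p_def qpoch_Suc)
  have eSuc: "e (Suc N) = (\<Sum>k\<le>Suc N. p u k * p v (Suc N - k))" by (simp only: e_def)
  \<comment> \<open>\<open>X\<close> eliminates the sum weighted by \<open>q ^ k\<close>, so that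
    \<open>E\<close> for \<open>Suc N\<close> involves values of \<open>e\<close> only.\<close>
  have "(\<Sum>k\<le>Suc N. q ^ k * p u k * p v (Suc N - k)) = e (Suc N) - u * e N"
    unfolding X[symmetric] eSuc sum_subtractf[symmetric]
    by (intro sum.cong) (auto simp: left_diff_distrib)
  with E[of "Suc N"] have e2: "(1 - q ^ Suc (Suc N)) * e (Suc (Suc N)) = u * e (Suc N) + v * (e (Suc N) - u * e N)"
    by simp
  have "hom_rogers_szego (Suc (Suc N)) u v q = qpoch q q (Suc N) * ((1 - q ^ Suc (Suc N)) * e (Suc (Suc N)))"
    unfolding h by (subst qpoch_Suc) simp
  also have "\<dots> = (u + v) * (qpoch q q (Suc N) * e (Suc N)) - u * v * (qpoch q q (Suc N) * e N)"
    unfolding e2 by (simp add: algebra_simps)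
  also have "qpoch q q (Suc N) * e N = (1 - q ^ Suc N) * hom_rogers_szego N u v q"
    by (simp add: h qpoch_Suc)
  finally show "hom_rogers_szego (Suc (Suc N)) u v q =
     (u + v) * hom_rogers_szego (Suc N) u v q - u * v * (1 - q ^ Suc N) * hom_rogers_szego N u v q"
    by (simp add: h mult.assoc)
qed

text \<open>Both sides obey the same recurrence. The constant \<open>- u * v\<close> of
  \<open>qmoment_1\<close> cancels in the difference of the endpoints, so the values for
  \<open>N = 1\<close> agree as well.\<close>

lemma qmoment_diff_eq_hom_rogers_szego:
  assumes "u \<noteq> 0" "v \<noteq> 0"
  shows "qmoment q u v v N - qmoment q u v u N =
           (qmoment q u v v 0 - qmoment q u v u 0) * hom_rogers_szego N u v q"
proof -
  define C where "C = qmoment q u v v 0 - qmoment q u v u 0"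
  have "qmoment q u v v N - qmoment q u v u N = C * hom_rogers_szego N u v q"
  proof (induction N rule: induct_nat_012)
    case 0
    thus ?case by (simp add: C_def)
  next
    case 1
    have "qmoment q u v v (Suc 0) = (u + v) * qmoment q u v v 0 - u * v"
      and "qmoment q u v u (Suc 0) = (u + v) * qmoment q u v u 0 - u * v"
      using qmoment_1[OF assms] by simp_all
    thus ?case using hom_rogers_szego_rec(1)[of u v] by (simp add: C_def right_diff_distrib mult.commute)
  next
    case (ge2 n)
    have "qmoment q u v v (Suc (Suc n)) - qmoment q u v u (Suc (Suc n)) =
        (u + v) * (qmoment q u v v (Suc n) - qmoment q u v u (Suc n)) -
        u * v * (1 - q ^ Suc n) * (qmoment q u v v n - qmoment q u v u n)"
      unfolding qmoment_rec[OF assms insertI1] qmoment_rec[OF assms insertI2[OF singletonI]]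
      by (simp add: algebra_simps)
    thus ?case unfolding ge2 hom_rogers_szego_rec(2) by (simp add: algebra_simps)
  qed
  thus ?thesis by (simp add: C_def)
qed

text \<open>For fixed \<open>k\<close>, \<open>qbinom q N k\<close> tends to
  \<open>1 / qpoch q q k\<close>, with a majorant proportional to \<open>norm (u / v) ^ k\<close>.
  The limiting series is the \<open>q\<close>-binomial series with upper parameter 0 at
  \<open>u / v\<close>.\<close>

lemma hom_rogers_szego_asymptotics:
  assumes "norm u < norm v"
  shows "(\<lambda>N. hom_rogers_szego N u v q / v ^ N) \<longlonglongrightarrow> 1 / qpoch_inf (u / v) q"
proof -
  have v: "v \<noteq> 0" using assms by auto
  have z: "norm (u / v) < 1" using assms v by (simp add: norm_divide)
  \<comment> \<open>Padding with zeros beyond \<open>N\<close> makes the finite sums series over a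
    fixed index set, as dominated convergence requires.\<close>
  define a where "a = (\<lambda>k N. if k \<le> N then qbinom q N k * (u / v) ^ k else 0)"
  have "suminf (\<lambda>k. a k N) = hom_rogers_szego N u v q / v ^ N" for N
  proof -
    have "suminf (\<lambda>k. a k N) = (\<Sum>k\<le>N. a k N)" by (rule suminf_finite) (auto simp: a_def)
    also have "\<dots> = hom_rogers_szego N u v q / v ^ N"
      unfolding hom_rogers_szego_def sum_divide_distrib
      using v by (intro sum.cong) (auto simp: a_def power_divide power_diff field_simps)
    finally show ?thesis .
  qed
  moreover have "(\<lambda>N. suminf (\<lambda>k. a k N)) \<longlonglongrightarrow> (\<Sum>k. (u / v) ^ k / qpoch q q k)"
  proof -
    obtain K where K: "\<And>k. norm (1 / qpoch q q k) \<le> K"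
      using bounded_qpoch_ratio[of 0] by (auto simp: qpoch_def[of 0])
    define E where "E = exp (norm q / (1 - norm q))"
    have lim: "(\<lambda>N. a k N) \<longlonglongrightarrow> (u / v) ^ k / qpoch q q k" for k
    proof -
      \<comment> \<open>Shifting the index by \<open>k\<close> keeps it in the range where
        \<open>a\<close> is not padded.\<close>
      have "(\<lambda>N. qpoch q q (N + k) / (qpoch q q k * qpoch q q N) * (u / v) ^ k) \<longlonglongrightarrow>
          qpoch_inf q q / (qpoch q q k * qpoch_inf q q) * (u / v) ^ k"
        using qpoch_nonzero[OF q] qpoch_inf_nonzero'[OF q]
        by (intro tendsto_intros LIMSEQ_ignore_initial_segment qpoch_LIMSEQ) auto
      also have "(\<lambda>N. qpoch q q (N + k) / (qpoch q q k * qpoch q q N) * (u / v) ^ k) = (\<lambda>N. a k (N + k))"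
        by (simp add: a_def qbinom_def)
      finally show ?thesis using qpoch_inf_nonzero'[OF q] by (simp add: LIMSEQ_offset)
    qed
    have bound: "norm (a k N) \<le> E * K * K * norm (u / v) ^ k" for k N
    proof (cases "k \<le> N")
      case True
      have "norm (a k N) = norm (qpoch q q N) * norm (1 / qpoch q q k) * norm (1 / qpoch q q (N - k)) * norm (u / v) ^ k"
        using True by (simp add: a_def qbinom_def norm_mult norm_divide norm_power)
      also have "\<dots> \<le> E * K * K * norm (u / v) ^ k"
        unfolding E_def using order.trans[OF norm_ge_zero K] norm_qpoch_le
        by (intro mult_mono K mult_nonneg_nonneg) auto
      finally show ?thesis .
    next
      case False
      thus ?thesis using order.trans[OF norm_ge_zero K] by (auto simp: a_def E_def)
    qed
    have "summable (\<lambda>k. E * K * K * norm (u / v) ^ k)"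
      using z by (intro summable_mult summable_geometric) auto
    with lim bound show ?thesis by (rule tannery_sequentially)
  qed
  moreover have "(\<Sum>k. (u / v) ^ k / qpoch q q k) = 1 / qpoch_inf (u / v) q"
    using qbinomial_sums[OF z, of 0] by (simp add: sums_iff qpoch_def[of 0])
  ultimately show ?thesis by simp
qed

text \<open>The powers \<open>(x * q ^ n / v) ^ N\<close> tend to 0 except for \<open>x = v\<close>
  and \<open>n = 0\<close>, so only the first node at the endpoint \<open>v\<close>
  survives.\<close>

lemma qmoment_asymptotics:
  assumes v: "v \<noteq> 0" and x: "x = v \<or> norm x < norm v"
  shows "(\<lambda>N. qmoment q u v x N / v ^ N) \<longlonglongrightarrow> (if x = v then v * qweight q u v v else 0)"
proof -
  obtain K where K: "\<And>n. norm (qweight q u v (x * q ^ n)) \<le> K"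
    using entire_bounded_qpow[OF holomorphic_qweight] by blast
  define a where "a = (\<lambda>n N. (x * q ^ n / v) ^ N * qweight q u v (x * q ^ n) * q ^ n)"
  define b where "b = (\<lambda>n::nat. if x = v \<and> n = 0 then qweight q u v v else 0)"
  have xv: "norm (x * q ^ n / v) \<le> 1" for n
    using norm_mult_qpow_le[of x n] v x by (auto simp: norm_divide)
  have eq: "qmoment q u v x N / v ^ N = x * (\<Sum>n. a n N)" for N
  proof -
    have "(\<Sum>n. a n N) = (\<Sum>n. (x * q ^ n) ^ N * qweight q u v (x * q ^ n) * q ^ n / v ^ N)"
      by (simp add: a_def power_divide)
    also have "\<dots> = (\<Sum>n. (x * q ^ n) ^ N * qweight q u v (x * q ^ n) * q ^ n) / v ^ N"
    proof (rule suminf_divide)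
      have "(\<lambda>x. x ^ N * qweight q u v x) holomorphic_on UNIV"
        by (intro holomorphic_intros holomorphic_qweight)
      from summable_norm_cancel[OF entire_summable_qpow[OF this]]
      show "summable (\<lambda>n. (x * q ^ n) ^ N * qweight q u v (x * q ^ n) * q ^ n)" by simp
    qed
    finally show ?thesis by (simp add: qmoment_def)
  qed
  have lim: "(\<lambda>N. a n N) \<longlonglongrightarrow> b n" for n
  proof (cases "x = v \<and> n = 0")
    case True
    thus ?thesis using v by (simp add: a_def b_def)
  next
    case False
    have "norm (x * q ^ n / v) < 1"
    proof (cases "x = v")
      case True
      hence "n > 0" using False by auto
      hence "norm q ^ n < 1" using q by (simp add: power_less_one_iff)
      thus ?thesis using True v by (simp add: norm_divide norm_mult norm_power)
    next
      case False
      thus ?thesis using norm_mult_qpow_le[of x n] v x by (auto simp: norm_divide)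
    qed
    hence "(\<lambda>N. (x * q ^ n / v) ^ N) \<longlonglongrightarrow> 0" by (rule LIMSEQ_power_zero)
    hence "(\<lambda>N. a n N) \<longlonglongrightarrow> 0 * qweight q u v (x * q ^ n) * q ^ n"
      unfolding a_def by (intro tendsto_mult_right)
    moreover have "b n = 0" using False by (auto simp: b_def)
    ultimately show ?thesis by simp
  qed
  have bound: "norm (a n N) \<le> K * norm q ^ n" for n N
  proof -
    have "norm (a n N) = norm (x * q ^ n / v) ^ N * norm (qweight q u v (x * q ^ n)) * norm q ^ n"
      by (simp add: a_def norm_mult norm_power)
    also have "\<dots> \<le> 1 * K * norm q ^ n"
      using xv order.trans[OF norm_ge_zero K] by (intro mult_mono K power_le_one) auto
    finally show ?thesis by simp
  qed
  have "summable (\<lambda>n. K * norm q ^ n)" by (intro summable_mult summable_norm_qpow)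
  with lim bound have "(\<lambda>N. \<Sum>n. a n N) \<longlonglongrightarrow> suminf b" by (rule tannery_sequentially)
  moreover have "suminf b = (\<Sum>n\<in>{0}. b n)" by (rule suminf_finite) (auto simp: b_def)
  ultimately have "(\<lambda>N. x * (\<Sum>n. a n N)) \<longlonglongrightarrow> x * b 0" by (intro tendsto_intros) simp
  thus ?thesis unfolding eq by (auto simp: b_def)
qed

text \<open>Two evaluations of the limit of the \<open>N\<close>-th moment over
  \<open>v ^ N\<close>: through the Rogers-Szego polynomials it is the zeroth moment over
  \<open>qpoch_inf (u / v) q\<close>, directly it is \<open>v * qweight q u v v\<close>.\<close>

lemma qmoment_0_diff_aux:
  assumes "u \<noteq> 0" "norm u < norm v"
  shows "qmoment q u v v 0 - qmoment q u v u 0 = v * qpochs_inf [q, u / v, q * v / u] q"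
proof -
  have v: "v \<noteq> 0" using assms by auto
  let ?C = "qmoment q u v v 0 - qmoment q u v u 0"
  have "(\<lambda>N. ?C * (hom_rogers_szego N u v q / v ^ N)) \<longlonglongrightarrow> ?C * (1 / qpoch_inf (u / v) q)"
    by (intro tendsto_intros hom_rogers_szego_asymptotics assms)
  moreover have "(\<lambda>N. qmoment q u v v N / v ^ N - qmoment q u v u N / v ^ N) \<longlonglongrightarrow> v * qweight q u v v - 0"
    using qmoment_asymptotics[OF v, of v u] qmoment_asymptotics[OF v, of u u] assms
    by (intro tendsto_diff) (auto split: if_splits)
  moreover have "qmoment q u v v N / v ^ N - qmoment q u v u N / v ^ N = ?C * (hom_rogers_szego N u v q / v ^ N)" for N
    using qmoment_diff_eq_hom_rogers_szego[OF assms(1) v, of N] by (simp add: diff_divide_distrib[symmetric])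
  ultimately have "?C * (1 / qpoch_inf (u / v) q) = v * qweight q u v v"
    using LIMSEQ_unique by fastforce
  moreover have "qpoch_inf (u / v) q \<noteq> 0"
    using assms v by (intro qpoch_inf_nonzero') (simp add: norm_divide)
  ultimately show ?thesis using v by (simp add: qpochs_inf_def qweight_def field_simps)
qed

text \<open>For fixed \<open>v\<close> both sides are holomorphic in \<open>u\<close> on the
  punctured plane, which is connected, and they agree on the punctured disc of radius
  \<open>norm v\<close>.\<close>

lemma qmoment_0_diff:
  assumes u: "u \<noteq> 0" and v: "v \<noteq> 0"
  shows "qmoment q u v v 0 - qmoment q u v u 0 = v * qpochs_inf [q, u / v, q * v / u] q"
proof -
  \<comment> \<open>At the nodes \<open>v * q ^ n\<close> the weight depends on \<open>v / u\<close>
    only, at \<open>u * q ^ n\<close> on \<open>u / v\<close> only, and by the same formula; one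
    entire function thus covers both endpoints.\<close>
  define B where "B = (\<lambda>z. \<Sum>n. (qpoch_inf (q * q ^ n * z) q * qpoch_inf (q * q ^ n) q) * q ^ n)"
  have "B holomorphic_on UNIV"
    unfolding B_def
  proof (intro holomorphic_suminf_qpow q holomorphic_intros)
    fix R :: real
    let ?E = "\<lambda>R. exp (R / (1 - norm q))"
    have "norm (qpoch_inf (q * q ^ n * z) q * qpoch_inf (q * q ^ n) q) \<le> ?E R * ?E 1"
      if "norm z \<le> R" for n z
    proof -
      have 1: "norm (q * q ^ n) \<le> 1" using norm_qpow_le_1[of "Suc n"] by (simp add: norm_mult norm_power)
      hence "norm (q * q ^ n * z) \<le> R"
        using that mult_mono[OF 1 that] by (simp add: norm_mult)
      with 1 show ?thesis unfolding norm_mult[of "qpoch_inf _ _"]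
        by (intro mult_mono bounded_qpoch_inf) auto
    qed
    thus "\<exists>K. \<forall>n z. norm z \<le> R \<longrightarrow> norm (qpoch_inf (q * q ^ n * z) q * qpoch_inf (q * q ^ n) q) \<le> K"
      by blast
  qed
  hence B: "(\<lambda>z. B (f z)) holomorphic_on S" if "f holomorphic_on S" for f S
    using holomorphic_on_compose_gen[OF that] by (auto simp: o_def)
  let ?L = "\<lambda>u. v * B (v / u) - u * B (u / v)"
  let ?R = "\<lambda>u. v * qpochs_inf [q, u / v, q * v / u] q"
  have L: "qmoment q w v v 0 - qmoment q w v w 0 = ?L w" if "w \<noteq> 0" for w
    using v that by (simp add: qmoment_def qweight_def B_def mult_ac)
  have "?L u = ?R u"
  proof (rule analytic_continuation_open[of "ball 0 (norm v) - {0}" "- {0}" ?L ?R])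
    show "ball 0 (norm v) - {0} \<noteq> ({} :: complex set)"
    proof -
      have "v / 2 \<in> ball 0 (norm v) - {0}" using v by (auto simp: norm_divide)
      thus ?thesis by blast
    qed
    show "connected (- {0 :: complex})" by (intro connected_punctured_universe) simp
    show "?L holomorphic_on - {0}" using v by (intro holomorphic_intros B) auto
    show "?R holomorphic_on - {0}" using v unfolding qpochs_inf_def list.map prod_list.Cons
      by (intro holomorphic_intros) auto
    fix z :: complex assume "z \<in> ball 0 (norm v) - {0}"
    thus "?L z = ?R z" using L[of z] qmoment_0_diff_aux[of z v] by auto
  qed (use u in \<open>auto intro: open_delete\<close>)
  thus ?thesis using L[OF u] by simp
qed

theorem qmoment_diff:
  assumes "u \<noteq> 0" "v \<noteq> 0"
  shows "qmoment q u v v N - qmoment q u v u N =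
           v * qpochs_inf [q, u / v, q * v / u] q * hom_rogers_szego N u v q"
  using qmoment_diff_eq_hom_rogers_szego[OF assms] qmoment_0_diff[OF assms] by simp

subsection \<open>Generating functions\<close>

text \<open>The Cauchy product of two \<open>q\<close>-binomial series, with parameters \<alpha> at
  \<open>a * x\<close> and 0 at \<open>b * x\<close>.\<close>

lemma hom_hahn_gen:
  assumes "norm (a * x) < 1" "norm (b * x) < 1"
  shows "summable (\<lambda>m. norm (hom_hahn \<alpha> m a b q / qpoch q q m * x ^ m))"
    and "(\<lambda>m. hom_hahn \<alpha> m a b q / qpoch q q m * x ^ m) sums
           (qpoch_inf (\<alpha> * (a * x)) q / (qpoch_inf (a * x) q * qpoch_inf (b * x) q))"
proof -
  let ?f = "\<lambda>k. qpoch \<alpha> q k / qpoch q q k * (a * x) ^ k"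
  let ?g = "\<lambda>k. qpoch 0 q k / qpoch q q k * (b * x) ^ k"
  have eq: "(\<Sum>k\<le>m. ?f k * ?g (m - k)) = hom_hahn \<alpha> m a b q / qpoch q q m * x ^ m" for m
    unfolding hom_hahn_def sum_divide_distrib sum_distrib_right
  proof (intro sum.cong refl)
    fix k assume "k \<in> {..m}"
    hence "x ^ m = x ^ k * x ^ (m - k)" by (simp flip: power_add)
    thus "?f k * ?g (m - k) = qbinom q m k * qpoch \<alpha> q k * a ^ k * b ^ (m - k) / qpoch q q m * x ^ m"
      using qpoch_nonzero[OF q] by (simp add: qbinom_def qpoch_def[of 0] power_mult_distrib)
  qed
  note f = qbinomial_summable[OF assms(1), of \<alpha>] and g = qbinomial_summable[OF assms(2), of 0]
  show "(\<lambda>m. hom_hahn \<alpha> m a b q / qpoch q q m * x ^ m) sums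
           (qpoch_inf (\<alpha> * (a * x)) q / (qpoch_inf (a * x) q * qpoch_inf (b * x) q))"
    using Cauchy_product_sums[OF f g] qbinomial_sums[OF assms(1), of \<alpha>] qbinomial_sums[OF assms(2), of 0]
    unfolding eq by (simp add: sums_iff)
  show "summable (\<lambda>m. norm (hom_hahn \<alpha> m a b q / qpoch q q m * x ^ m))"
  proof (rule summable_comparison_test')
    show "summable (\<lambda>m. \<Sum>k\<le>m. norm (?f k) * norm (?g (m - k)))"
      by (rule summable_Cauchy_product) (use f g in simp_all)
    show "norm (norm (hom_hahn \<alpha> m a b q / qpoch q q m * x ^ m)) \<le> (\<Sum>k\<le>m. norm (?f k) * norm (?g (m - k)))" for m
      unfolding eq[symmetric] norm_mult[symmetric] real_norm_def abs_norm_cancel by (rule norm_sum)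
  qed
qed

lemma hom_hahn_abs_summable_on:
  assumes "norm (a * x) < 1" "norm (b * x) < 1"
  shows "(\<lambda>m. norm (hom_hahn \<alpha> m a b q / qpoch q q m * x ^ m)) summable_on UNIV"
  by (subst summable_on_UNIV_nonneg_real_iff[OF norm_ge_zero]) (rule hom_hahn_gen(1)[OF assms])

text \<open>Choose \<open>t\<close> above \<open>norm u\<close> and \<open>norm v\<close> with
  \<open>norm w * t < 1\<close> for all four parameters. The Rogers-Szego generating function
  converges at \<open>1 / t\<close>, so these polynomials are bounded by a multiple of
  \<open>t ^ m\<close>, and the product of the two Hahn series at \<open>t\<close>
  dominates.\<close>

lemma hahn_term_summable:
  assumes "\<And>w. w \<in> {a, b, c, d} \<Longrightarrow> norm (w * u) < 1 \<and> norm (w * v) < 1"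
  shows "hahn_term q \<alpha> \<beta> a b c d u v summable_on UNIV"
proof -
  define r where "r = max (norm u) (norm v)"
  define p where "p = Max (norm ` {a, b, c, d})"
  have p: "norm w \<le> p" if "w \<in> {a, b, c, d}" for w
    unfolding p_def using that by (intro Max_ge) auto
  have p0: "p \<ge> 0" using p[of a] by (auto intro: order.trans[OF norm_ge_zero])
  have "p \<in> norm ` {a, b, c, d}" unfolding p_def by (intro Max_in) auto
  hence pr: "p * r < 1" using assms by (auto simp: r_def max_def norm_mult)
  \<comment> \<open>The increment over \<open>r\<close> is positive yet keeps
    \<open>p * t < 1\<close>; the denominator \<open>p + 1\<close> also allows
    \<open>p = 0\<close>.\<close>
  define t where "t = r + (1 - p * r) / (p + 1)"
  have t: "t > r" using pr p0 by (simp add: t_def)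
  have t0: "t > 0" using t by (simp add: r_def max_def split: if_splits) (smt (verit) norm_ge_zero)+
  have "p * t = p * r + (p / (p + 1)) * (1 - p * r)" by (simp add: t_def distrib_left)
  also have "\<dots> < p * r + 1 * (1 - p * r)"
    using pr p0 by (intro add_strict_left_mono mult_strict_right_mono) auto
  finally have pt: "p * t < 1" by simp
  have wt: "norm (w * of_real t) < 1" if "w \<in> {a, b, c, d}" for w
    using le_less_trans[OF mult_right_mono[OF p[OF that], of t] pt] t0 by (simp add: norm_mult)
  have "norm (u * of_real (1 / t)) < 1" "norm (v * of_real (1 / t)) < 1"
    using t t0 by (auto simp: norm_mult norm_divide r_def field_simps)
  from hom_hahn_gen(1)[OF this, of 0]
  have "summable (\<lambda>m. norm (hom_rogers_szego m u v q / qpoch q q m * of_real (1 / t) ^ m))"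
    unfolding hom_hahn_0 .
  from summable_LIMSEQ_zero[OF summable_norm_cancel[OF this]]
  have "Bseq (\<lambda>m. hom_rogers_szego m u v q / qpoch q q m * of_real (1 / t) ^ m)"
    by (intro convergent_imp_Bseq convergentI)
  then obtain K where K: "\<And>m. norm (hom_rogers_szego m u v q / qpoch q q m * of_real (1 / t) ^ m) \<le> K"
    by (auto simp: Bseq_def)
  define E where "E = exp (norm q / (1 - norm q))"
  have h: "norm (hom_rogers_szego m u v q) \<le> K * E * t ^ m" for m
  proof -
    have "norm (hom_rogers_szego m u v q) =
        norm (hom_rogers_szego m u v q / qpoch q q m * of_real (1 / t) ^ m) * norm (qpoch q q m) * t ^ m"
      using t0 qpoch_nonzero[OF q, of m] by (simp add: norm_mult norm_divide norm_power power_divide)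
    also have "\<dots> \<le> K * E * t ^ m"
      unfolding E_def using t0 norm_qpoch_le order.trans[OF norm_ge_zero K]
      by (intro mult_right_mono mult_mono K) auto
    finally show ?thesis .
  qed
  let ?P = "\<lambda>m. hom_hahn \<alpha> m a b q / qpoch q q m * of_real t ^ m"
  let ?Q = "\<lambda>n. hom_hahn \<beta> n c d q / qpoch q q n * of_real t ^ n"
  have "(\<lambda>m. norm (?P m)) summable_on UNIV" "(\<lambda>n. norm (?Q n)) summable_on UNIV"
    by (intro hom_hahn_abs_summable_on wt; simp)+
  hence "(\<lambda>p. norm (case p of (m, n) \<Rightarrow> ?P m * ?Q n)) summable_on UNIV \<times> UNIV" by (rule abs_summable_on_Times)
  hence "(\<lambda>x. norm (K * E) * norm (case x of (m, n) \<Rightarrow> ?P m * ?Q n)) summable_on UNIV"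
    by (intro summable_on_cmult_right) simp
  hence "(\<lambda>x. norm (hahn_term q \<alpha> \<beta> a b c d u v x)) summable_on UNIV"
  proof (rule summable_on_comparison_test)
    fix x :: "nat \<times> nat"
    obtain m n where x: "x = (m, n)" by force
    have "norm (hahn_term q \<alpha> \<beta> a b c d u v x) =
        norm (hom_hahn \<alpha> m a b q / qpoch q q m) * norm (hom_hahn \<beta> n c d q / qpoch q q n) *
        norm (hom_rogers_szego (m + n) u v q)"
      by (simp add: x hahn_term_def norm_mult norm_divide)
    also have "\<dots> \<le> norm (hom_hahn \<alpha> m a b q / qpoch q q m) * norm (hom_hahn \<beta> n c d q / qpoch q q n) *
        (norm (K * E) * t ^ (m + n))"
      using t0 by (intro mult_left_mono order.trans[OF h] mult_right_mono) auto
    also have "\<dots> = norm (K * E) * norm (case x of (m, n) \<Rightarrow> ?P m * ?Q n)"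
      using t0 by (simp add: x norm_mult norm_divide norm_power power_add)
    finally show "norm (hahn_term q \<alpha> \<beta> a b c d u v x) \<le> norm (K * E) * norm (case x of (m, n) \<Rightarrow> ?P m * ?Q n)" .
  qed simp
  thus ?thesis by (rule abs_summable_summable)
qed

section \<open>Jackson sums with cleared denominators\<close>

lemma locally_bounded_seq_qpoch: "locally_bounded_seq (\<lambda>n z. qpoch (z * w * x) q n)"
  unfolding locally_bounded_seq_def
proof (intro allI exI impI)
  fix R n and z :: complex assume "norm z \<le> R"
  hence "norm (z * w * x) \<le> R * norm w * norm x" by (auto simp: norm_mult intro!: mult_right_mono)
  thus "norm (qpoch (z * w * x) q n) \<le> exp (R * norm w * norm x / (1 - norm q))" by (rule bounded_qpoch)
qed

lemma locally_bounded_seq_qpoch_inf: "locally_bounded_seq (\<lambda>n z. qpoch_inf (a * (z * w) * (x * q ^ n)) q)"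
  unfolding locally_bounded_seq_def
proof (intro allI exI impI)
  fix R n and z :: complex assume z: "norm z \<le> R"
  have "norm (a * (z * w) * (x * q ^ n)) = norm z * (norm a * norm w) * norm (x * q ^ n)" by (simp add: norm_mult)
  also have "\<dots> \<le> R * (norm a * norm w) * norm x"
    using z norm_mult_qpow_le[of x n] order.trans[OF norm_ge_zero z] by (intro mult_mono mult_right_mono) auto
  finally show "norm (qpoch_inf (a * (z * w) * (x * q ^ n)) q) \<le> exp (R * (norm a * norm w) * norm x / (1 - norm q))"
    by (rule bounded_qpoch_inf)
qed

lemma locally_bounded_seq_const:
  assumes "f holomorphic_on UNIV"
  shows "locally_bounded_seq (\<lambda>n z. f (x * q ^ n))"
  using entire_bounded_qpow[OF assms] unfolding locally_bounded_seq_def by blast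

lemma hahn_locally_bounded:
  "locally_bounded_seq (\<lambda>n s. qweight q u v (x * q ^ n) *
     (qpoch_inf (\<alpha> * (s * a) * (x * q ^ n)) q * (qpoch_inf (\<beta> * (s * c) * (x * q ^ n)) q *
     (qpoch (s * a * x) q n * (qpoch (s * b * x) q n * (qpoch (s * c * x) q n * qpoch (s * d * x) q n))))))"
  by (intro locally_bounded_seq_mult locally_bounded_seq_qpoch locally_bounded_seq_qpoch_inf
       locally_bounded_seq_const holomorphic_qweight)

lemma holomorphic_hahn_numerator:
  "(\<lambda>s. hahn_numerator q \<alpha> \<beta> (s * a) (s * b) (s * c) (s * d) u v x) holomorphic_on UNIV"
  unfolding hahn_numerator_def
proof (rule holomorphic_on_mult[OF holomorphic_on_const], rule holomorphic_suminf_qpow, goal_cases)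
  case (1 n)
  show ?case by (intro holomorphic_intros)
next
  case (2 R)
  show ?case using hahn_locally_bounded unfolding locally_bounded_seq_def by blast
qed

text \<open>Splitting off the first \<open>n\<close> factors of each
  \<open>qpoch_inf (w * x) q\<close> leaves the denominator at the node \<open>x * q ^ n\<close>.
  Over the common denominator at \<open>x\<close> the finite products move into the
  numerator.\<close>

lemma hahn_kernel_sums:
  assumes nz: "qpochs_inf [a * x, b * x, c * x, d * x] q \<noteq> 0"
  shows "(\<lambda>n. x * (qweight q u v (x * q ^ n) * hahn_kernel q \<alpha> \<beta> a b c d (x * q ^ n) * q ^ n)) sums
           (hahn_numerator q \<alpha> \<beta> a b c d u v x / qpochs_inf [a * x, b * x, c * x, d * x] q)"
proof -
  let ?D = "qpochs_inf [a * x, b * x, c * x, d * x] q"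
  let ?g = "\<lambda>n. qweight q u v (x * q ^ n) *
     (qpoch_inf (\<alpha> * a * (x * q ^ n)) q * (qpoch_inf (\<beta> * c * (x * q ^ n)) q *
     (qpoch (a * x) q n * (qpoch (b * x) q n * (qpoch (c * x) q n * qpoch (d * x) q n)))))"
  obtain K where "\<And>n. norm (?g n) \<le> K"
    using hahn_locally_bounded[of u v x \<alpha> a \<beta> c b d, unfolded locally_bounded_seq_def, rule_format, of 1]
    by (metis mult_1 norm_one order_refl)
  hence "summable (\<lambda>n. norm (?g n * q ^ n))" by (rule summable_qpow_mult)
  note sums = summable_sums[OF summable_norm_cancel[OF this]]
  have "(\<lambda>n. x * (?g n * q ^ n) / ?D) sums (hahn_numerator q \<alpha> \<beta> a b c d u v x / ?D)"
    unfolding hahn_numerator_def by (rule sums_divide[OF sums_mult[OF sums]])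
  moreover have "x * (?g n * q ^ n) / ?D =
      x * (qweight q u v (x * q ^ n) * hahn_kernel q \<alpha> \<beta> a b c d (x * q ^ n) * q ^ n)" for n
  proof -
    have split: "qpoch_inf (w * x) q = qpoch (w * x) q n * qpoch_inf (w * (x * q ^ n)) q" for w
      using qpoch_inf_split[of "w * x" n] by (simp add: mult.assoc)
    have D: "?D = qpoch (a * x) q n * (qpoch (b * x) q n * (qpoch (c * x) q n * qpoch (d * x) q n)) *
        qpochs_inf [a * (x * q ^ n), b * (x * q ^ n), c * (x * q ^ n), d * (x * q ^ n)] q"
      unfolding qpochs_inf_def list.map prod_list.Cons split[of a] split[of b] split[of c] split[of d]
      by simp
    from nz show ?thesis unfolding D hahn_kernel_def
      by (simp add: qpochs_inf_def)
  qed
  ultimately show ?thesis by simp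
qed

text \<open>Fubini for the triple family \<open>F\<close> over the Jackson index \<open>j\<close>
  and the series indices \<open>m\<close> and \<open>n\<close>: summing first over
  \<open>(m, n)\<close> gives the kernel at each node, summing first over \<open>j\<close> gives the
  moments.\<close>

lemma hahn_moment_has_sum:
  assumes w: "\<And>w. w \<in> {a, b, c, d} \<Longrightarrow> norm (w * x) < 1"
  shows "((\<lambda>(m, n). hom_hahn \<alpha> m a b q / qpoch q q m * (hom_hahn \<beta> n c d q / qpoch q q n) *
             qmoment q u v x (m + n)) has_sum
           (hahn_numerator q \<alpha> \<beta> a b c d u v x / qpochs_inf [a * x, b * x, c * x, d * x] q)) UNIV"
proof -
  define P where "P = (\<lambda>m. hom_hahn \<alpha> m a b q / qpoch q q m)"
  define Q where "Q = (\<lambda>n. hom_hahn \<beta> n c d q / qpoch q q n)"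
  define g where "g = (\<lambda>j. x * (qweight q u v (x * q ^ j) * q ^ j))"
  define F where "F = (\<lambda>(j, m, n). g j * (P m * (x * q ^ j) ^ m * (Q n * (x * q ^ j) ^ n)))"
  have g_sum: "summable (\<lambda>j. norm (g j))"
    using summable_mult[OF entire_summable_qpow[OF holomorphic_qweight], of "norm x"]
    by (simp add: g_def norm_mult)
  have wy: "norm (w * (x * q ^ j)) < 1" if "w \<in> {a, b, c, d}" for w j
    using w[OF that] norm_mult_qpow_le[of "w * x" j] by (simp add: mult.assoc)
  have abs: "(\<lambda>m. norm (P m * (x * q ^ j) ^ m)) summable_on UNIV" "(\<lambda>m. norm (Q m * (x * q ^ j) ^ m)) summable_on UNIV" for j
    unfolding P_def Q_def by (intro hom_hahn_abs_summable_on wy; simp)+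
  have "(\<lambda>p. norm (case p of (m, n) \<Rightarrow> P m * x ^ m * (Q n * x ^ n))) summable_on UNIV \<times> UNIV"
    using abs[of 0] by (intro abs_summable_on_Times) simp_all
  moreover have "(\<lambda>j. norm (g j)) summable_on UNIV"
    using g_sum by (intro norm_summable_imp_summable_on) simp
  ultimately have "(\<lambda>p. norm (case p of (j, p) \<Rightarrow> g j * (case p of (m, n) \<Rightarrow> P m * x ^ m * (Q n * x ^ n)))) summable_on UNIV \<times> (UNIV \<times> UNIV)"
    by (intro abs_summable_on_Times[of g])
  \<comment> \<open>Since \<open>norm (x * q ^ j) \<le> norm x\<close>, the double series at node
    \<open>j\<close> is dominated by that at \<open>x\<close>, and the weights \<open>g j\<close>
    are absolutely summable.\<close>
  hence "(\<lambda>p. norm (F p)) summable_on UNIV \<times> (UNIV \<times> UNIV)"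
  proof (rule Infinite_Sum.abs_summable_on_comparison_test, clarify)
    fix j m n
    have "norm (F (j, m, n)) = norm (g j) * (norm (P m) * norm (Q n)) * norm (x * q ^ j) ^ (m + n)"
      by (simp add: F_def norm_mult norm_power power_add)
    also have "\<dots> \<le> norm (g j) * (norm (P m) * norm (Q n)) * norm x ^ (m + n)"
      by (intro mult_left_mono power_mono norm_mult_qpow_le) auto
    also have "\<dots> = norm (g j * (P m * x ^ m * (Q n * x ^ n)))"
      by (simp add: norm_mult norm_power power_add)
    finally show "norm (F (j, m, n)) \<le> norm (g j * (P m * x ^ m * (Q n * x ^ n)))" .
  qed
  from abs_summable_summable[OF this] have "F summable_on UNIV \<times> UNIV" by simp
  then obtain S where S: "(F has_sum S) (UNIV \<times> UNIV)" by (auto simp: summable_on_def)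
  have nz: "qpochs_inf [a * x, b * x, c * x, d * x] q \<noteq> 0"
    using w by (auto simp: qpochs_inf_def intro!: qpoch_inf_nonzero')
  have "((\<lambda>j. g j * hahn_kernel q \<alpha> \<beta> a b c d (x * q ^ j)) has_sum S) UNIV"
  proof (rule has_sum_SigmaD[OF S])
    fix j
    have "((\<lambda>(m, n). P m * (x * q ^ j) ^ m * (Q n * (x * q ^ j) ^ n)) has_sum
       (qpoch_inf (\<alpha> * (a * (x * q ^ j))) q / (qpoch_inf (a * (x * q ^ j)) q * qpoch_inf (b * (x * q ^ j)) q) *
       (qpoch_inf (\<beta> * (c * (x * q ^ j))) q / (qpoch_inf (c * (x * q ^ j)) q * qpoch_inf (d * (x * q ^ j)) q))))
        (UNIV \<times> UNIV)"
      unfolding P_def Q_def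
      by (intro has_sum_Times abs[unfolded P_def Q_def] norm_summable_imp_has_sum hom_hahn_gen wy) auto
    from has_sum_cmult_right[OF this, of "g j"]
    show "((\<lambda>p. F (j, p)) has_sum g j * hahn_kernel q \<alpha> \<beta> a b c d (x * q ^ j)) UNIV"
      by (simp add: F_def case_prod_unfold hahn_kernel_def qpochs_inf_def mult.assoc)
  qed
  hence "(\<lambda>j. g j * hahn_kernel q \<alpha> \<beta> a b c d (x * q ^ j)) sums S" by (rule has_sum_imp_sums)
  hence "S = hahn_numerator q \<alpha> \<beta> a b c d u v x / qpochs_inf [a * x, b * x, c * x, d * x] q"
    using hahn_kernel_sums[OF nz, of u v \<alpha> \<beta>] by (intro sums_unique2[of _ S]) (simp_all add: g_def mult_ac)
  moreover have "((\<lambda>(p, j). F (j, p)) has_sum S) (UNIV \<times> UNIV)"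
    using S by (subst (asm) has_sum_swap)
  hence "((\<lambda>(m, n). P m * Q n * qmoment q u v x (m + n)) has_sum S) UNIV"
  proof (rule has_sum_SigmaD)
    fix p :: "nat \<times> nat"
    obtain m n where p: "p = (m, n)" by force
    have F: "F (j, p) = P m * Q n * (x * ((x * q ^ j) ^ (m + n) * qweight q u v (x * q ^ j) * q ^ j))" for j
      by (simp add: F_def p g_def power_add mult_ac)
    have "summable (\<lambda>j. norm (F (j, p)))"
    proof -
      have "(\<lambda>x. x ^ (m + n) * qweight q u v x) holomorphic_on UNIV"
        by (intro holomorphic_intros holomorphic_qweight)
      from summable_mult[OF entire_summable_qpow[OF this], of "norm (P m * Q n * x)"]
      show ?thesis unfolding F by (simp add: norm_mult mult_ac)
    qed
    moreover have "(\<lambda>j. F (j, p)) sums (P m * Q n * qmoment q u v x (m + n))"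
      unfolding F by (intro sums_mult qmoment_sums)
    ultimately show "((\<lambda>j. case (p, j) of (p, j) \<Rightarrow> F (j, p)) has_sum
        (case p of (m, n) \<Rightarrow> P m * Q n * qmoment q u v x (m + n))) UNIV"
      by (simp add: p norm_summable_imp_has_sum)
  qed
  ultimately show ?thesis by (simp add: P_def Q_def)
qed

text \<open>Subtract the expansions at the two endpoints; \<open>qmoment_diff\<close> turns each
  difference of moments into a Rogers-Szego polynomial.\<close>

lemma hahn_term_has_sum:
  assumes "u \<noteq> 0" "v \<noteq> 0"
    and w: "\<And>w. w \<in> {a, b, c, d} \<Longrightarrow> norm (w * u) < 1 \<and> norm (w * v) < 1"
  shows "((\<lambda>p. v * qpochs_inf [q, u / v, q * v / u] q * hahn_term q \<alpha> \<beta> a b c d u v p) has_sum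
     (hahn_numerator q \<alpha> \<beta> a b c d u v v / qpochs_inf [a * v, b * v, c * v, d * v] q -
      hahn_numerator q \<alpha> \<beta> a b c d u v u / qpochs_inf [a * u, b * u, c * u, d * u] q)) UNIV"
proof -
  let ?c = "\<lambda>p. hom_hahn \<alpha> (fst p) a b q / qpoch q q (fst p) * (hom_hahn \<beta> (snd p) c d q / qpoch q q (snd p))"
  have m: "((\<lambda>p. ?c p * qmoment q u v x (fst p + snd p)) has_sum
      hahn_numerator q \<alpha> \<beta> a b c d u v x / qpochs_inf [a * x, b * x, c * x, d * x] q) UNIV"
    if "x \<in> {u, v}" for x
    by (rule hahn_moment_has_sum[unfolded case_prod_unfold]) (use w that in auto)
  have "((\<lambda>p. ?c p * qmoment q u v v (fst p + snd p) + - (?c p * qmoment q u v u (fst p + snd p))) has_sum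
     (hahn_numerator q \<alpha> \<beta> a b c d u v v / qpochs_inf [a * v, b * v, c * v, d * v] q +
      - (hahn_numerator q \<alpha> \<beta> a b c d u v u / qpochs_inf [a * u, b * u, c * u, d * u] q))) UNIV"
    by (intro has_sum_add has_sum_uminus[THEN iffD2] m) (simp_all only: minus_minus m insertI1 insertI2)
  thus ?thesis
    unfolding add_uminus_conv_diff right_diff_distrib[symmetric] qmoment_diff[OF assms(1,2)]
    by (simp add: case_prod_unfold hahn_term_def mult_ac)
qed

subsection \<open>Analytic continuation\<close>

lemma hahn_term_infsum:
  assumes uv: "u \<noteq> 0" "v \<noteq> 0"
    and summable: "hahn_term q \<alpha> \<beta> a b c d u v summable_on UNIV"
    and Du: "qpochs_inf [a * u, b * u, c * u, d * u] q \<noteq> 0"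
    and Dv: "qpochs_inf [a * v, b * v, c * v, d * v] q \<noteq> 0"
  shows "v * qpochs_inf [q, u / v, q * v / u] q * infsum (hahn_term q \<alpha> \<beta> a b c d u v) UNIV =
     hahn_numerator q \<alpha> \<beta> a b c d u v v / qpochs_inf [a * v, b * v, c * v, d * v] q -
     hahn_numerator q \<alpha> \<beta> a b c d u v u / qpochs_inf [a * u, b * u, c * u, d * u] q"
proof -
  define T where "T = hahn_term q \<alpha> \<beta> a b c d u v"
  define C where "C = v * qpochs_inf [q, u / v, q * v / u] q"
  define t where "t = (\<lambda>N. \<Sum>m\<le>N. T (m, N - m))"
  \<comment> \<open>The double series for parameters scaled by \<open>s\<close>, collected along
    \<open>m + n = N\<close>. Its coefficients are absolutely summable, so it converges on the
    closed unit disc.\<close>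
  define F where "F = (\<lambda>s. \<Sum>N. t N * s ^ N)"
  define D where "D = (\<lambda>x s. qpochs_inf [s * a * x, s * b * x, s * c * x, s * d * x] q)"
  define M where "M = (\<lambda>x s. hahn_numerator q \<alpha> \<beta> (s * a) (s * b) (s * c) (s * d) u v x)"
  have abs: "(\<lambda>p. norm (T p)) summable_on UNIV"
    using summable unfolding T_def by (simp only: summable_on_iff_abs_summable_on_complex)
  have t_abs: "summable (\<lambda>N. norm (t N))"
  proof (rule summable_comparison_test')
    show "summable (\<lambda>N. \<Sum>m\<le>N. norm (T (m, N - m)))"
      using has_sum_imp_sums[OF has_sum_diagonals[OF has_sum_infsum[OF abs]]] by (rule sums_summable)
    show "norm (norm (t N)) \<le> (\<Sum>m\<le>N. norm (T (m, N - m)))" for N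
      unfolding t_def real_norm_def abs_norm_cancel by (rule norm_sum)
  qed
  have bound: "norm (t N * s ^ N) \<le> norm (t N)" if "norm s \<le> 1" for N s
    using mult_left_mono[OF power_le_one[OF norm_ge_zero that, of N], of "norm (t N)"]
    by (simp add: norm_mult norm_power)
  have F_sums: "(\<lambda>N. t N * s ^ N) sums F s" if "norm s \<le> 1" for s
    unfolding F_def using bound[OF that]
    by (intro summable_sums summable_comparison_test'[OF t_abs]) auto
  have F_eq: "F s = S" if "norm s \<le> 1" "((\<lambda>(m, n). T (m, n) * s ^ (m + n)) has_sum S) UNIV" for s S
  proof -
    have "(\<Sum>m\<le>N. case (m, N - m) of (m, n) \<Rightarrow> T (m, n) * s ^ (m + n)) = t N * s ^ N" for N
      unfolding t_def sum_distrib_right by (intro sum.cong) auto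
    with has_sum_imp_sums[OF has_sum_diagonals[OF that(2)]] have "(\<lambda>N. t N * s ^ N) sums S"
      by simp
    with F_sums[OF that(1)] show ?thesis by (rule sums_unique2)
  qed
  have F_hol: "F holomorphic_on ball 0 1"
    by (rule power_series_holomorphic[of 0 1 t]) (use F_sums in simp)
  have D_hol: "D x holomorphic_on S" for x S
    unfolding D_def qpochs_inf_def list.map prod_list.Cons by (intro holomorphic_intros)
  have M_hol: "M x holomorphic_on S" for x S
    unfolding M_def by (rule holomorphic_on_subset[OF holomorphic_hahn_numerator]) simp
  \<comment> \<open>The identity is cross-multiplied because \<open>D u\<close> and
    \<open>D v\<close> may have zeros in the unit disc.\<close>
  let ?L = "\<lambda>s. C * F s * (D v s * D u s)" and ?R = "\<lambda>s. M v s * D u s - M u s * D v s"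
  have eq: "?L s = ?R s" if s: "s \<in> ball 0 1" for s
  proof (rule analytic_continuation_open[of _ "ball 0 1" ?L ?R s])
    \<comment> \<open>A neighbourhood of 0 on which the scaled parameters are small enough for
      termwise integration.\<close>
    let ?U = "ball 0 1 \<inter> (\<Inter>w\<in>{a, b, c, d}. \<Inter>x\<in>{u, v}. {s. norm (s * w * x) < 1})"
    show "open ?U"
      by (intro open_Int open_INT finite.intros ballI open_ball open_Collect_less continuous_intros)
    have "0 \<in> ?U" by simp
    thus "?U \<noteq> {}" by blast
    fix s assume s: "s \<in> ?U"
    hence w: "norm (w * u) < 1 \<and> norm (w * v) < 1" if "w \<in> {s * a, s * b, s * c, s * d}" for w
      using that by auto
    have D: "D u s \<noteq> 0" "D v s \<noteq> 0"
      using w unfolding D_def by (auto simp: qpochs_inf_def intro!: qpoch_inf_nonzero')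
    have "((\<lambda>p. C * hahn_term q \<alpha> \<beta> (s * a) (s * b) (s * c) (s * d) u v p) has_sum
        (M v s / D v s - M u s / D u s)) UNIV"
      unfolding C_def M_def D_def by (rule hahn_term_has_sum[OF uv w])
    moreover have "hahn_term q \<alpha> \<beta> (s * a) (s * b) (s * c) (s * d) u v summable_on UNIV"
      by (rule hahn_term_summable[OF w])
    hence sm: "(\<lambda>(m, n). T (m, n) * s ^ (m + n)) summable_on UNIV"
      by (simp only: T_def hahn_term_scale[symmetric] case_prod_eta)
    have "((\<lambda>(m, n). T (m, n) * s ^ (m + n)) has_sum F s) UNIV"
      using F_eq[OF _ has_sum_infsum[OF sm]] has_sum_infsum[OF sm] s by simp
    hence "((\<lambda>p. C * hahn_term q \<alpha> \<beta> (s * a) (s * b) (s * c) (s * d) u v p) has_sum C * F s) UNIV"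
      unfolding T_def hahn_term_scale[symmetric] case_prod_eta by (rule has_sum_cmult_right)
    ultimately have "C * F s = M v s / D v s - M u s / D u s" by (rule has_sum_unique[rotated])
    thus "?L s = ?R s" using D by (simp add: field_simps)
  qed (use s in \<open>auto intro!: holomorphic_intros F_hol D_hol M_hol\<close>)
  \<comment> \<open>Points of the open disc tending to 1, where continuation gives no information
    directly.\<close>
  define X :: "nat \<Rightarrow> complex" where "X = (\<lambda>k. of_real (1 - inverse (real (Suc k))))"
  have norm_X: "norm (X k) < 1" for k
  proof -
    have "0 < inverse (real (Suc k))" "inverse (real (Suc k)) \<le> 1" by (auto simp: field_simps)
    thus ?thesis unfolding X_def norm_of_real by linarith
  qed
  have "X \<longlonglongrightarrow> of_real (1 - 0)"
    unfolding X_def by (intro tendsto_of_real tendsto_diff tendsto_const LIMSEQ_inverse_real_of_nat)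
  hence X: "X \<longlonglongrightarrow> 1" by simp
  \<comment> \<open>The boundary point is reached by dominated convergence, with majorant
    \<open>norm (t N)\<close>.\<close>
  have "(\<lambda>k. F (X k)) \<longlonglongrightarrow> (\<Sum>N. t N * 1 ^ N)"
    unfolding F_def
    by (rule tannery_sequentially[OF _ bound t_abs]) (intro tendsto_intros X less_imp_le norm_X)+
  hence FX: "(\<lambda>k. F (X k)) \<longlonglongrightarrow> F 1" by (simp add: F_def)
  have cont: "(\<lambda>k. f (X k)) \<longlonglongrightarrow> f 1" if "f holomorphic_on UNIV" for f :: "complex \<Rightarrow> complex"
    using holomorphic_on_imp_continuous_on[OF that] X
    by (auto simp: continuous_on_eq_continuous_at intro: isCont_tendsto_compose)
  have "(\<lambda>k. ?L (X k)) \<longlonglongrightarrow> ?L 1"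
    by (intro tendsto_mult FX cont D_hol tendsto_const)
  moreover have "(\<lambda>k. ?R (X k)) \<longlonglongrightarrow> ?R 1"
    by (intro tendsto_mult tendsto_diff cont D_hol M_hol)
  moreover have "?L (X k) = ?R (X k)" for k
    using norm_X by (intro eq) simp
  ultimately have "?L 1 = ?R 1" using LIMSEQ_unique by fastforce
  moreover have "F 1 = infsum T UNIV"
    by (rule F_eq) (use summable in \<open>simp_all add: T_def has_sum_infsum\<close>)
  ultimately show ?thesis using Du Dv by (simp add: C_def D_def M_def T_def field_simps)
qed

end

text \<open>The double series is an unordered sum, for which summability of complex terms means
  absolute convergence. As \<open>infsum\<close> defaults to 0 otherwise, the identity is asserted
  under summability, and the first conjunct provides a region of parameters where this
  holds.\<close>

theorem theorem4p7:
  fixes q a b c d u v \<alpha> \<beta> :: complex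
  assumes "norm q < 1"
    and "u \<noteq> 0" and "v \<noteq> 0"
    and no_zero_factors:
      "\<And>x w k n. x \<in> {u * q ^ n, v * q ^ n} \<Longrightarrow> w \<in> {a, b, c, d} \<Longrightarrow> 1 - w * x * q ^ k \<noteq> 0"
  shows "let T = (\<lambda>(m, n). hom_hahn \<alpha> m a b q * hom_hahn \<beta> n c d q *
                    (hom_rogers_szego (m + n) u v q / (qpoch q q m * qpoch q q n)))
    in ((\<forall>w\<in>{a, b, c, d}. norm (w * u) < 1 \<and> norm (w * v) < 1) \<longrightarrow> T summable_on UNIV) \<and>
       (T summable_on UNIV \<longrightarrow>
          jackson_integral q u v
            (\<lambda>x. qpochs_inf [q * x / u, q * x / v, \<alpha> * a * x, \<beta> * c * x] q /
                  qpochs_inf [a * x, b * x, c * x, d * x] q) =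
          (1 - q) * v * qpochs_inf [q, u / v, q * v / u] q * (\<Sum>\<^sub>\<infinity>(m, n)\<in>UNIV. T (m, n)))"
proof -
  note q = assms(1)
  have D: "qpochs_inf [a * x, b * x, c * x, d * x] q \<noteq> 0" if "x \<in> {u, v}" for x
    using no_zero_factors[of x 0] that by (auto simp: qpochs_inf_def intro!: qpoch_inf_nonzero[OF q])
  define f where "f = (\<lambda>x. qpochs_inf [q * x / u, q * x / v, \<alpha> * a * x, \<beta> * c * x] q /
                  qpochs_inf [a * x, b * x, c * x, d * x] q)"
  have f: "f x = qweight q u v x * hahn_kernel q \<alpha> \<beta> a b c d x" for x
    by (simp add: f_def qweight_def hahn_kernel_def qpochs_inf_def mult.assoc)
  let ?J = "\<lambda>x. hahn_numerator q \<alpha> \<beta> a b c d u v x / qpochs_inf [a * x, b * x, c * x, d * x] q"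
  have "(\<lambda>n. v * (f (v * q ^ n) * q ^ n) - u * (f (u * q ^ n) * q ^ n)) sums (?J v - ?J u)"
    unfolding f by (intro sums_diff hahn_kernel_sums q D) auto
  hence J: "jackson_integral q u v f = (1 - q) * (?J v - ?J u)"
    by (simp add: jackson_integral_def sums_iff left_diff_distrib mult.assoc)
  have "(1 - q) * (?J v - ?J u) =
      (1 - q) * v * qpochs_inf [q, u / v, q * v / u] q * infsum (hahn_term q \<alpha> \<beta> a b c d u v) UNIV"
    if "hahn_term q \<alpha> \<beta> a b c d u v summable_on UNIV"
    using hahn_term_infsum[OF q assms(2,3) that] D by (simp add: mult.assoc)
  with J hahn_term_summable[OF q, of a b c d u v \<alpha> \<beta>] show ?thesis
    unfolding Let_def f_def[symmetric] hahn_term_def[symmetric] case_prod_eta by auto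
qed

end
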